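(* For every $v\in\mathbb{N}^n$, the multinomial lattice $\mathcal{L}(v)$ is a bounded lattice.
   Context: $\mathbb{N}$ is the set of non-negative integers. For $v=(v_1,\ldots,v_n)\in\mathbb{N}^n$, $\mathcal{L}(v)$ is the set of words over the alphabet $\{a_1,\ldots,a_n\}$ in which each letter $a_i$ occurs exactly $v_i$ times. It is ordered by the reflexive and transitive closure of the relation $\rightarrow$, where $w\rightarrow u$ iff $w=w_1a_ia_jw_2$ and $u=w_1a_ja_iw_2$ for some words $w_1,w_2$ and some $i<j$. This ordered set is a (finite) lattice. A finite lattice is called bounded (in the sense of McKenzie) if it is a quotient of a finitely generated free lattice (with top and bottom) by a quotient map which has both a left and a right adjoint (as an order-preserving map). *)

theory Defs
  imports "HOL-Algebra.Galois_Connection"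
begin

section \<open>Free lattices with top and bottom\<close>

datatype 'x lat_term =
    Gen 'x
  | Bot
  | Top
  | Meet "'x lat_term" "'x lat_term"
  | Join "'x lat_term" "'x lat_term"

text \<open>The least preorder on terms for which \<^const>\<open>Bot\<close>, \<^const>\<open>Top\<close>, \<^const>\<open>Meet\<close> and
  \<^const>\<open>Join\<close> are bottom, top, binary infimum and binary supremum.\<close>

inductive lat_le :: "'x lat_term \<Rightarrow> 'x lat_term \<Rightarrow> bool" where
  refl: "lat_le s s"
| trans: "lat_le s t \<Longrightarrow> lat_le t u \<Longrightarrow> lat_le s u"
| bot: "lat_le Bot s"
| top: "lat_le s Top"
| meet_left: "lat_le (Meet s t) s"
| meet_right: "lat_le (Meet s t) t"
| meet_greatest: "lat_le u s \<Longrightarrow> lat_le u t \<Longrightarrow> lat_le u (Meet s t)"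
| join_left: "lat_le s (Join s t)"
| join_right: "lat_le t (Join s t)"
| join_least: "lat_le s u \<Longrightarrow> lat_le t u \<Longrightarrow> lat_le (Join s t) u"

definition lat_terms :: "'x set \<Rightarrow> 'x lat_term set" where
  "lat_terms X = {t. set_lat_term t \<subseteq> X}"

definition lat_equiv :: "'x set \<Rightarrow> 'x lat_term rel" where
  "lat_equiv X = {(s, t) \<in> lat_terms X \<times> lat_terms X. lat_le s t \<and> lat_le t s}"

definition free_bounded_lattice :: "'x set \<Rightarrow> 'x lat_term set gorder" where
  "free_bounded_lattice X =
     \<lparr>carrier = lat_terms X // lat_equiv X, eq = (=),
      le = (\<lambda>A B. \<exists>s\<in>A. \<exists>t\<in>B. lat_le s t)\<rparr>"

definition bounded_lattice_hom :: "'a gorder \<Rightarrow> 'b gorder \<Rightarrow> ('a \<Rightarrow> 'b) set" where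
  "bounded_lattice_hom K L =
     {h \<in> carrier K \<rightarrow> carrier L. join_pres K L h \<and> meet_pres K L h \<and>
        h \<top>\<^bsub>K\<^esub> = \<top>\<^bsub>L\<^esub> \<and> h \<bottom>\<^bsub>K\<^esub> = \<bottom>\<^bsub>L\<^esub>}"

text \<open>The lemmas \<open>free_bounded_lattice\<close> and \<open>free_bounded_lattice_universal\<close> below show that this
  is the free bounded lattice over \<open>X\<close>.\<close>

lemma lat_le_Join_iff: "lat_le (Join s t) u \<longleftrightarrow> lat_le s u \<and> lat_le t u"
  by (meson lat_le.join_left lat_le.join_right lat_le.join_least lat_le.trans)

lemma lat_le_Meet_iff: "lat_le u (Meet s t) \<longleftrightarrow> lat_le u s \<and> lat_le u t"
  by (meson lat_le.meet_left lat_le.meet_right lat_le.meet_greatest lat_le.trans)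

lemma equiv_lat_equiv: "equiv (lat_terms X) (lat_equiv X)"
proof (rule equivI)
  show "trans (lat_equiv X)"
    unfolding lat_equiv_def trans_def by (blast intro: lat_le.trans)
qed (auto simp: lat_equiv_def refl_on_def sym_def intro: lat_le.refl)

lemma lat_terms_simps [simp]:
  "Gen x \<in> lat_terms X \<longleftrightarrow> x \<in> X" "Bot \<in> lat_terms X" "Top \<in> lat_terms X"
  "Meet s t \<in> lat_terms X \<longleftrightarrow> s \<in> lat_terms X \<and> t \<in> lat_terms X"
  "Join s t \<in> lat_terms X \<longleftrightarrow> s \<in> lat_terms X \<and> t \<in> lat_terms X"
  by (auto simp: lat_terms_def)

definition lat_class :: "'x set \<Rightarrow> 'x lat_term \<Rightarrow> 'x lat_term set" where
  "lat_class X t = lat_equiv X `` {t}"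

lemma carrier_free: "carrier (free_bounded_lattice X) = lat_class X ` lat_terms X"
  by (auto simp: free_bounded_lattice_def quotient_def lat_class_def)

lemma lat_class_closed: "t \<in> lat_terms X \<Longrightarrow> lat_class X t \<in> carrier (free_bounded_lattice X)"
  by (simp add: carrier_free)

lemma free_cases:
  assumes "a \<in> carrier (free_bounded_lattice X)"
  obtains t where "t \<in> lat_terms X" "a = lat_class X t"
  using assms by (auto simp: carrier_free)

lemma eq_free: "eq (free_bounded_lattice X) = (=)"
  by (simp add: free_bounded_lattice_def)

lemma le_free:
  assumes "s \<in> lat_terms X" "t \<in> lat_terms X"
  shows "lat_class X s \<sqsubseteq>\<^bsub>free_bounded_lattice X\<^esub> lat_class X t \<longleftrightarrow> lat_le s t"
proof
  assume "lat_class X s \<sqsubseteq>\<^bsub>free_bounded_lattice X\<^esub> lat_class X t"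
  then obtain s' t' where "lat_le s s'" "lat_le s' t'" "lat_le t' t"
    by (auto simp: free_bounded_lattice_def lat_class_def lat_equiv_def)
  then show "lat_le s t" by (meson lat_le.trans)
next
  assume "lat_le s t"
  with assms show "lat_class X s \<sqsubseteq>\<^bsub>free_bounded_lattice X\<^esub> lat_class X t"
    by (auto simp: free_bounded_lattice_def lat_class_def lat_equiv_def intro: lat_le.refl)
qed

lemma lat_class_eqI:
  assumes "s \<in> lat_terms X" "t \<in> lat_terms X" "lat_le s t" "lat_le t s"
  shows "lat_class X s = lat_class X t"
  unfolding lat_class_def
  by (rule equiv_class_eq[OF equiv_lat_equiv]) (use assms in \<open>auto simp: lat_equiv_def\<close>)

lemma partial_order_free: "partial_order (free_bounded_lattice X)"
proof unfold_locales
  fix x y z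
  assume "x \<sqsubseteq>\<^bsub>free_bounded_lattice X\<^esub> y" "y \<sqsubseteq>\<^bsub>free_bounded_lattice X\<^esub> z"
    and "x \<in> carrier (free_bounded_lattice X)" "y \<in> carrier (free_bounded_lattice X)"
      "z \<in> carrier (free_bounded_lattice X)"
  then show "x \<sqsubseteq>\<^bsub>free_bounded_lattice X\<^esub> z"
    by (clarsimp simp: carrier_free le_free) (rule lat_le.trans)
next
  fix x y
  assume "x \<sqsubseteq>\<^bsub>free_bounded_lattice X\<^esub> y" "y \<sqsubseteq>\<^bsub>free_bounded_lattice X\<^esub> x"
    and "x \<in> carrier (free_bounded_lattice X)" "y \<in> carrier (free_bounded_lattice X)"
  then show "x .=\<^bsub>free_bounded_lattice X\<^esub> y"
    by (clarsimp simp: carrier_free eq_free le_free) (rule lat_class_eqI)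
next
  fix x
  assume "x \<in> carrier (free_bounded_lattice X)"
  then show "x \<sqsubseteq>\<^bsub>free_bounded_lattice X\<^esub> x"
    by (auto simp: carrier_free le_free intro: lat_le.refl)
qed (simp_all add: eq_free)

lemma least_join_free:
  assumes "s \<in> lat_terms X" "t \<in> lat_terms X"
  shows "least (free_bounded_lattice X) (lat_class X (Join s t))
           (Upper (free_bounded_lattice X) {lat_class X s, lat_class X t})"
proof -
  let ?F = "free_bounded_lattice X"
  have "lat_class X (Join s t) \<in> Upper ?F {lat_class X s, lat_class X t}"
    using assms by (auto simp: Upper_def lat_class_closed le_free intro: lat_le.join_left lat_le.join_right)
  moreover have "lat_class X (Join s t) \<sqsubseteq>\<^bsub>?F\<^esub> u" if "u \<in> Upper ?F {lat_class X s, lat_class X t}" for u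
  proof -
    from that obtain p where p: "p \<in> lat_terms X" "u = lat_class X p"
      unfolding Upper_def by (blast elim: free_cases)
    with that assms have "lat_le s p" "lat_le t p"
      by (simp_all add: Upper_def lat_class_closed le_free)
    with p assms show ?thesis by (simp add: le_free lat_le_Join_iff)
  qed
  ultimately show ?thesis by (auto simp: least_def Upper_def)
qed

lemma greatest_meet_free:
  assumes "s \<in> lat_terms X" "t \<in> lat_terms X"
  shows "greatest (free_bounded_lattice X) (lat_class X (Meet s t))
           (Lower (free_bounded_lattice X) {lat_class X s, lat_class X t})"
proof -
  let ?F = "free_bounded_lattice X"
  have "lat_class X (Meet s t) \<in> Lower ?F {lat_class X s, lat_class X t}"
    using assms by (auto simp: Lower_def lat_class_closed le_free intro: lat_le.meet_left lat_le.meet_right)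
  moreover have "u \<sqsubseteq>\<^bsub>?F\<^esub> lat_class X (Meet s t)" if "u \<in> Lower ?F {lat_class X s, lat_class X t}" for u
  proof -
    from that obtain p where p: "p \<in> lat_terms X" "u = lat_class X p"
      unfolding Lower_def by (blast elim: free_cases)
    with that assms have "lat_le p s" "lat_le p t"
      by (simp_all add: Lower_def lat_class_closed le_free)
    with p assms show ?thesis by (simp add: le_free lat_le_Meet_iff)
  qed
  ultimately show ?thesis by (auto simp: greatest_def Lower_def)
qed

lemma least_bot_free:
  "least (free_bounded_lattice X) (lat_class X Bot) (carrier (free_bounded_lattice X))"
  unfolding least_def by (auto simp: carrier_free le_free intro: lat_le.bot)

lemma greatest_top_free:
  "greatest (free_bounded_lattice X) (lat_class X Top) (carrier (free_bounded_lattice X))"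
  unfolding greatest_def by (auto simp: carrier_free le_free intro: lat_le.top)

lemma free_bounded_lattice: "bounded_lattice (free_bounded_lattice X)"
proof -
  interpret partial_order "free_bounded_lattice X" by (rule partial_order_free)
  show ?thesis
  proof unfold_locales
    fix x y
    assume "x \<in> carrier (free_bounded_lattice X)" "y \<in> carrier (free_bounded_lattice X)"
    then obtain s t where "x = lat_class X s" "y = lat_class X t"
      "s \<in> lat_terms X" "t \<in> lat_terms X"
      by (auto simp: carrier_free)
    then show "\<exists>u. least (free_bounded_lattice X) u (Upper (free_bounded_lattice X) {x, y})"
      and "\<exists>u. greatest (free_bounded_lattice X) u (Lower (free_bounded_lattice X) {x, y})"
      using least_join_free greatest_meet_free by blast+
  qed (use least_bot_free greatest_top_free in blast)+
qed

lemma (in partial_order) join_eqI: "least L u (Upper L {x, y}) \<Longrightarrow> x \<squnion> y = u"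
  unfolding join_def sup_def by (rule someI2) (auto intro: least_unique)

lemma (in partial_order) meet_eqI: "greatest L u (Lower L {x, y}) \<Longrightarrow> x \<sqinter> y = u"
  unfolding meet_def inf_def by (rule someI2) (auto intro: greatest_unique)

lemma (in partial_order) top_eqI: "greatest L u (carrier L) \<Longrightarrow> \<top> = u"
  unfolding top_def by (rule someI2) (auto intro: greatest_unique)

lemma (in partial_order) bottom_eqI: "least L u (carrier L) \<Longrightarrow> \<bottom> = u"
  unfolding bottom_def by (rule someI2) (auto intro: least_unique)

lemmas join_free = partial_order.join_eqI[OF partial_order_free least_join_free]
lemmas meet_free = partial_order.meet_eqI[OF partial_order_free greatest_meet_free]
lemmas top_free = partial_order.top_eqI[OF partial_order_free greatest_top_free]
lemmas bottom_free = partial_order.bottom_eqI[OF partial_order_free least_bot_free]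

primrec lat_eval :: "'b gorder \<Rightarrow> ('x \<Rightarrow> 'b) \<Rightarrow> 'x lat_term \<Rightarrow> 'b" where
  "lat_eval L f (Gen x) = f x"
| "lat_eval L f Bot = \<bottom>\<^bsub>L\<^esub>"
| "lat_eval L f Top = \<top>\<^bsub>L\<^esub>"
| "lat_eval L f (Meet s t) = lat_eval L f s \<sqinter>\<^bsub>L\<^esub> lat_eval L f t"
| "lat_eval L f (Join s t) = lat_eval L f s \<squnion>\<^bsub>L\<^esub> lat_eval L f t"

lemma lat_eval_closed:
  assumes "bounded_lattice L" "\<And>x. f x \<in> carrier L"
  shows "lat_eval L f t \<in> carrier L"
proof -
  interpret bounded_lattice L by fact
  show ?thesis by (induction t) (auto intro: assms)
qed

lemma lat_eval_mono:
  assumes "bounded_lattice L" "\<And>x. f x \<in> carrier L" "lat_le s t"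
  shows "lat_eval L f s \<sqsubseteq>\<^bsub>L\<^esub> lat_eval L f t"
proof -
  interpret bounded_lattice L by fact
  note closed = lat_eval_closed[OF assms(1,2)]
  from assms(3) show ?thesis
  proof (induction rule: lat_le.induct)
    case (trans s t u)
    show ?case by (rule le_trans[OF trans.IH closed closed closed])
  qed (auto intro: closed join_le join_left join_right meet_le meet_left meet_right
      bottom_lower top_higher)
qed

lemma lat_eval_cong:
  "(\<And>x. x \<in> set_lat_term t \<Longrightarrow> f x = g x) \<Longrightarrow> lat_eval L f t = lat_eval L g t"
  by (induction t) auto

theorem free_bounded_lattice_universal:
  assumes L: "bounded_lattice L" and f: "f \<in> X \<rightarrow> carrier L"
  shows "\<exists>h \<in> bounded_lattice_hom (free_bounded_lattice X) L.
           (\<forall>x\<in>X. h (lat_class X (Gen x)) = f x) \<and>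
           (\<forall>h' \<in> bounded_lattice_hom (free_bounded_lattice X) L.
              (\<forall>x\<in>X. h' (lat_class X (Gen x)) = f x) \<longrightarrow>
              (\<forall>a \<in> carrier (free_bounded_lattice X). h' a = h a))"
proof -
  interpret L: bounded_lattice L by fact
  interpret F: bounded_lattice "free_bounded_lattice X" by (rule free_bounded_lattice)
  define g where "g x = (if x \<in> X then f x else \<bottom>\<^bsub>L\<^esub>)" for x
  have g: "g x \<in> carrier L" for x using f by (auto simp: g_def)
  define h where "h A = lat_eval L g (SOME t. t \<in> A)" for A
  have h: "h (lat_class X t) = lat_eval L g t" if t: "t \<in> lat_terms X" for t
  proof -
    have "(SOME s. s \<in> lat_class X t) \<in> lat_class X t"
      by (rule someI[where P = "\<lambda>s. s \<in> lat_class X t" and x = t])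
        (use t in \<open>auto simp: lat_class_def lat_equiv_def intro: lat_le.refl\<close>)
    then have "lat_le (SOME s. s \<in> lat_class X t) t" "lat_le t (SOME s. s \<in> lat_class X t)"
      by (auto simp: lat_class_def lat_equiv_def)
    then show ?thesis
      unfolding h_def by (intro L.le_antisym lat_eval_mono lat_eval_closed L g)
  qed
  have lat: "lattice L" "lattice (free_bounded_lattice X)" by unfold_locales
  let ?F = "free_bounded_lattice X"
  have "h \<in> carrier ?F \<rightarrow> carrier L"
    by (rule funcsetI, erule free_cases) (simp add: h lat_eval_closed[OF L g])
  moreover have "h (a \<squnion>\<^bsub>?F\<^esub> b) = h a \<squnion>\<^bsub>L\<^esub> h b" "h (a \<sqinter>\<^bsub>?F\<^esub> b) = h a \<sqinter>\<^bsub>L\<^esub> h b"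
    if ab: "a \<in> carrier ?F" "b \<in> carrier ?F" for a b
  proof -
    from ab obtain s t where "s \<in> lat_terms X" "a = lat_class X s"
      "t \<in> lat_terms X" "b = lat_class X t"
      by (meson free_cases)
    then show "h (a \<squnion>\<^bsub>?F\<^esub> b) = h a \<squnion>\<^bsub>L\<^esub> h b" "h (a \<sqinter>\<^bsub>?F\<^esub> b) = h a \<sqinter>\<^bsub>L\<^esub> h b"
      by (simp_all add: h join_free meet_free)
  qed
  ultimately have hom: "h \<in> bounded_lattice_hom ?F L"
    using lat by (simp add: bounded_lattice_hom_def join_pres_def meet_pres_def h top_free bottom_free)
  have uniq: "h' (lat_class X t) = h (lat_class X t)"
    if h': "h' \<in> bounded_lattice_hom (free_bounded_lattice X) L"
      and gen: "\<forall>x\<in>X. h' (lat_class X (Gen x)) = f x" and t: "t \<in> lat_terms X" for h' t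
  proof -
    have "h' (lat_class X t) = lat_eval L g t" using t
    proof (induction t)
      case (Gen x)
      then show ?case using gen by (simp add: g_def)
    next
      case Bot
      then show ?case using h' by (simp add: bounded_lattice_hom_def bottom_free)
    next
      case Top
      then show ?case using h' by (simp add: bounded_lattice_hom_def top_free)
    next
      case (Meet s t)
      then have "h' (lat_class X s \<sqinter>\<^bsub>free_bounded_lattice X\<^esub> lat_class X t)
          = h' (lat_class X s) \<sqinter>\<^bsub>L\<^esub> h' (lat_class X t)"
        using h' by (simp add: bounded_lattice_hom_def meet_pres_def lat_class_closed)
      with Meet show ?case by (simp add: meet_free)
    next
      case (Join s t)
      then have "h' (lat_class X s \<squnion>\<^bsub>free_bounded_lattice X\<^esub> lat_class X t)
          = h' (lat_class X s) \<squnion>\<^bsub>L\<^esub> h' (lat_class X t)"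
        using h' by (simp add: bounded_lattice_hom_def join_pres_def lat_class_closed)
      with Join show ?case by (simp add: join_free)
    qed
    with h t show ?thesis by simp
  qed
  show ?thesis
  proof (rule bexI[OF _ hom], intro conjI ballI impI)
    show "h (lat_class X (Gen x)) = f x" if "x \<in> X" for x
      using that by (simp add: h g_def)
  next
    fix h' a
    assume "h' \<in> bounded_lattice_hom ?F L" "\<forall>x\<in>X. h' (lat_class X (Gen x)) = f x" "a \<in> carrier ?F"
    then show "h' a = h a"
      by (metis free_cases uniq)
  qed
qed


section \<open>Bounded lattices in the sense of McKenzie\<close>

text \<open>Not to be confused with the library's \<^locale>\<open>bounded_lattice\<close> (a lattice with top and
  bottom). The two adjunction clauses say that \<open>h\<close> has a left and a right adjoint, respectively.\<close>

definition mckenzie_bounded :: "'a gorder \<Rightarrow> bool" where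
  "mckenzie_bounded L \<longleftrightarrow>
     finite (carrier L) \<and> lattice L \<and>
     (\<exists>(X :: nat set) h. finite X \<and>
        h \<in> bounded_lattice_hom (free_bounded_lattice X) L \<and>
        h ` carrier (free_bounded_lattice X) = carrier L \<and>
        upper_adjoint L (free_bounded_lattice X) h \<and>
        lower_adjoint (free_bounded_lattice X) L h)"


section \<open>Multinomial lattices\<close>

text \<open>The letter \<open>a\<^sub>i\<close> is represented by its index \<open>i \<in> {1..n}\<close>, and a vector
  in \<open>\<nat>\<^sup>n\<close> by a function of which only the values on \<open>{1..n}\<close> matter.\<close>

definition multinomial_words :: "nat \<Rightarrow> (nat \<Rightarrow> nat) \<Rightarrow> nat list set" where
  "multinomial_words n v = {w. set w \<subseteq> {1..n} \<and> (\<forall>i\<in>{1..n}. count_list w i = v i)}"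

definition swap_step :: "nat list \<Rightarrow> nat list \<Rightarrow> bool" where
  "swap_step w u \<longleftrightarrow>
     (\<exists>w1 w2 i j. i < j \<and> w = w1 @ [i, j] @ w2 \<and> u = w1 @ [j, i] @ w2)"

definition multinomial_lattice :: "nat \<Rightarrow> (nat \<Rightarrow> nat) \<Rightarrow> nat list gorder" where
  "multinomial_lattice n v =
     \<lparr>carrier = multinomial_words n v, eq = (=), le = swap_step\<^sup>*\<^sup>*\<rparr>"

end

theory Submission
  imports Defs "HOL-Library.Product_Lexorder"
begin

text \<open>
  Let \<open>f\<close> map a finite set \<open>X\<close> of variables onto a finite lattice \<open>L\<close>. The induced homomorphism from the
  free lattice has a left adjoint iff for every \<open>a\<close> there is a least term whose value is above \<open>a\<close>,
  and a right adjoint iff there is a greatest term whose value is below \<open>a\<close>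
  (\<open>mckenzie_boundedI\<close>). Reading words backwards reverses the order of a multinomial lattice, and
  exchanging meets and joins reverses the order of terms; so it suffices to find least terms
  (\<open>greatest_term_exists\<close>).

  Least terms exist as soon as \<open>L\<close> is join-generated by finitely many ranked elements with the
  following property: a generator that lies below \<open>b \<squnion> c\<close>, but neither below \<open>b\<close> nor below \<open>c\<close>, lies
  below every upper bound of the generators of smaller rank that are below \<open>b\<close> or below \<open>c\<close>. (In the
  theory of free lattices one says that join dependency has no cycles.) The least term for a generator is then, by recursion on the rank, the meet of the variables above it and of the
  joins above it of terms already found (\<open>least_term_exists\<close>).

  In a word, number the copies of each letter from left to right and order all copies
  lexicographically. The word is determined by its inversions, the pairs \<open>x < y\<close> with \<open>y\<close> to the left
  of \<open>x\<close>. The order on words is inclusion of inversion sets (\<open>swap_steps_iff\<close>), the inversion sets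
  are the transitive and co-transitive parts of \<open><\<close> that relate no two copies of the same letter
  (\<open>word_with_inversions\<close>), and the inversion set of a join is the transitive closure of the
  union (\<open>join_inversions\<close>).

  The generators are the words whose inversions form an arc: given \<open>p < q\<close>, the copies from \<open>p\<close> to \<open>q\<close>
  are split into a part containing \<open>p\<close> and a part containing \<open>q\<close>, and a pair is inverted if its
  smaller member is in the first part and its larger member in the second. The rank is the number of
  copies from \<open>p\<close> to \<open>q\<close>. Every inversion of a word is the outermost pair of some arc below the word.
  Hence, if an arc lies below the join of two words with inversion sets \<open>B\<close> and \<open>C\<close>, the arcs of smaller
  rank below these words supply all pairs of \<open>B \<union> C\<close> between \<open>p\<close> and \<open>q\<close> except possibly
  \<open>(p, q)\<close>. Every pair of the given arc is a chain of pairs so supplied, unless it is \<open>(p, q)\<close> and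
  belongs to \<open>B \<union> C\<close>. If \<open>(p, q)\<close> is in \<open>B\<close>, say, while the arc is not contained in \<open>B\<close>, co-transitivity of \<open>B\<close> at a missing pair splits \<open>(p, q)\<close> into two
  pairs that were already obtained (\<open>short_inversions_generate_arc\<close>).
\<close>

section \<open>A criterion for least preimages in free lattices\<close>

lemma (in lattice) le_meet_iff:
  assumes "a \<in> carrier L" "b \<in> carrier L" "c \<in> carrier L"
  shows "c \<sqsubseteq> a \<sqinter> b \<longleftrightarrow> c \<sqsubseteq> a \<and> c \<sqsubseteq> b"
proof safe
  assume c: "c \<sqsubseteq> a \<sqinter> b"
  show "c \<sqsubseteq> a" by (rule le_trans[OF c meet_left]) (use assms in auto)
  show "c \<sqsubseteq> b" by (rule le_trans[OF c meet_right]) (use assms in auto)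
qed (use assms meet_le in blast)

lemma (in lattice) join_le_iff:
  assumes "a \<in> carrier L" "b \<in> carrier L" "c \<in> carrier L"
  shows "a \<squnion> b \<sqsubseteq> c \<longleftrightarrow> a \<sqsubseteq> c \<and> b \<sqsubseteq> c"
proof safe
  assume c: "a \<squnion> b \<sqsubseteq> c"
  show "a \<sqsubseteq> c" by (rule le_trans[OF join_left c]) (use assms in auto)
  show "b \<sqsubseteq> c" by (rule le_trans[OF join_right c]) (use assms in auto)
qed (use assms join_le in blast)

lemma finite_Meet_term:
  fixes L :: "'a gorder" (structure)
  assumes L: "bounded_lattice L" and f: "\<And>x. f x \<in> carrier L"
    and C: "finite C" "\<tau> ` C \<subseteq> lat_terms X"
  shows "\<exists>m\<in>lat_terms X. (\<forall>u. lat_le u m \<longleftrightarrow> (\<forall>k\<in>C. lat_le u (\<tau> k))) \<and>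
    (\<forall>a\<in>carrier L. a \<sqsubseteq> lat_eval L f m \<longleftrightarrow> (\<forall>k\<in>C. a \<sqsubseteq> lat_eval L f (\<tau> k)))"
proof -
  interpret bounded_lattice L by fact
  note closed = lat_eval_closed[where f = f, OF L f]
  show ?thesis
    using C
  proof (induction C)
    case empty
    show ?case by (intro bexI[of _ Top]) (auto intro: lat_le.top top_higher)
  next
    case (insert k C)
    then obtain m where m: "m \<in> lat_terms X" "\<forall>u. lat_le u m \<longleftrightarrow> (\<forall>k\<in>C. lat_le u (\<tau> k))"
        "\<forall>a\<in>carrier L. a \<sqsubseteq> lat_eval L f m \<longleftrightarrow> (\<forall>k\<in>C. a \<sqsubseteq> lat_eval L f (\<tau> k))"
      by auto
    have "a \<sqsubseteq> lat_eval L f (\<tau> k) \<sqinter> lat_eval L f m \<longleftrightarrow> a \<sqsubseteq> lat_eval L f (\<tau> k) \<and> a \<sqsubseteq> lat_eval L f m"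
      if "a \<in> carrier L" for a
      by (rule le_meet_iff) (use closed that in auto)
    with m insert.prems show ?case
      by (intro bexI[of _ "Meet (\<tau> k) m"]) (auto simp: lat_le_Meet_iff)
  qed
qed

lemma finite_Join_term:
  fixes L :: "'a gorder" (structure)
  assumes L: "bounded_lattice L" and f: "\<And>x. f x \<in> carrier L"
    and C: "finite C" "\<tau> ` C \<subseteq> lat_terms X"
  shows "\<exists>m\<in>lat_terms X. (\<forall>u. lat_le m u \<longleftrightarrow> (\<forall>k\<in>C. lat_le (\<tau> k) u)) \<and>
    (\<forall>a\<in>carrier L. lat_eval L f m \<sqsubseteq> a \<longleftrightarrow> (\<forall>k\<in>C. lat_eval L f (\<tau> k) \<sqsubseteq> a))"
proof -
  interpret bounded_lattice L by fact
  note closed = lat_eval_closed[where f = f, OF L f]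
  show ?thesis
    using C
  proof (induction C)
    case empty
    show ?case by (intro bexI[of _ Bot]) (auto intro: lat_le.bot bottom_lower)
  next
    case (insert k C)
    then obtain m where m: "m \<in> lat_terms X" "\<forall>u. lat_le m u \<longleftrightarrow> (\<forall>k\<in>C. lat_le (\<tau> k) u)"
        "\<forall>a\<in>carrier L. lat_eval L f m \<sqsubseteq> a \<longleftrightarrow> (\<forall>k\<in>C. lat_eval L f (\<tau> k) \<sqsubseteq> a)"
      by auto
    have "lat_eval L f (\<tau> k) \<squnion> lat_eval L f m \<sqsubseteq> a \<longleftrightarrow> lat_eval L f (\<tau> k) \<sqsubseteq> a \<and> lat_eval L f m \<sqsubseteq> a"
      if "a \<in> carrier L" for a
      by (rule join_le_iff) (use closed that in auto)
    with m insert.prems show ?case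
      by (intro bexI[of _ "Join (\<tau> k) m"]) (auto simp: lat_le_Join_iff)
  qed
qed

text \<open>
  Join dependency without cycles, phrased for a join-generating family: the rank \<open>\<rho>\<close> decreases along
  dependencies. The last assumption quantifies over upper bounds \<open>u\<close> so as to speak of the join of a
  set of generators without naming it.
\<close>

locale ranked_join_covers = bounded_lattice L for L :: "'a gorder" (structure) +
  fixes K :: "'k set" and e :: "'k \<Rightarrow> 'a" and \<rho> :: "'k \<Rightarrow> nat"
  assumes finite_generators: "finite K"
    and generator_closed: "\<kappa> \<in> K \<Longrightarrow> e \<kappa> \<in> carrier L"
    and generator_not_bottom: "\<kappa> \<in> K \<Longrightarrow> \<not> e \<kappa> \<sqsubseteq> \<bottom>"
    and generators_dense: "\<lbrakk>a \<in> carrier L; b \<in> carrier L; \<And>\<kappa>. \<kappa> \<in> K \<Longrightarrow> e \<kappa> \<sqsubseteq> a \<Longrightarrow> e \<kappa> \<sqsubseteq> b\<rbrakk>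
      \<Longrightarrow> a \<sqsubseteq> b"
    and refine_cover: "\<lbrakk>\<kappa> \<in> K; b \<in> carrier L; c \<in> carrier L; u \<in> carrier L; e \<kappa> \<sqsubseteq> b \<squnion> c;
      \<not> e \<kappa> \<sqsubseteq> b; \<not> e \<kappa> \<sqsubseteq> c;
      \<And>\<mu>. \<mu> \<in> K \<Longrightarrow> \<rho> \<mu> < \<rho> \<kappa> \<Longrightarrow> e \<mu> \<sqsubseteq> b \<or> e \<mu> \<sqsubseteq> c \<Longrightarrow> e \<mu> \<sqsubseteq> u\<rbrakk> \<Longrightarrow> e \<kappa> \<sqsubseteq> u"
begin

(* As an introduction rule, antisymmetry turns every equation into inequalities between
   arbitrary elements, and proof search diverges. *)
declare le_antisym [rule del]

lemma bounded_lattice_L: "bounded_lattice L" by unfold_locales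

definition least_term :: "('x \<Rightarrow> 'a) \<Rightarrow> 'x set \<Rightarrow> 'a \<Rightarrow> 'x lat_term \<Rightarrow> bool" where
  "least_term f X a t \<longleftrightarrow> t \<in> lat_terms X \<and> a \<sqsubseteq> lat_eval L f t \<and>
     (\<forall>s\<in>lat_terms X. a \<sqsubseteq> lat_eval L f s \<longrightarrow> lat_le t s)"

text \<open>
  Whether \<open>e \<kappa> \<sqsubseteq> lat_eval L f s\<close> forces \<open>m\<close> below \<open>s\<close> is decided by induction on \<open>s\<close>. Meets are
  harmless for any \<open>m\<close>, and variables are taken care of by making them meetands of \<open>m\<close>. For joins, only
  finitely many sets of smaller generators can occur in a cover, so a meetand for each of them suffices.
\<close>

lemma least_term_generator:
  assumes X: "finite X" and f: "\<And>x. f x \<in> carrier L" and "\<kappa> \<in> K"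
  shows "\<exists>t. least_term f X (e \<kappa>) t"
  using \<open>\<kappa> \<in> K\<close>
proof (induction "\<rho> \<kappa>" arbitrary: \<kappa> rule: less_induct)
  case less
  note closed = lat_eval_closed[where f = f, OF bounded_lattice_L f]
  define K' where "K' = {\<mu>\<in>K. \<rho> \<mu> < \<rho> \<kappa>}"
  have "\<forall>\<mu>\<in>K'. \<exists>t. least_term f X (e \<mu>) t" using less.hyps by (auto simp: K'_def)
  then obtain \<tau> where \<tau>: "\<And>\<mu>. \<mu> \<in> K' \<Longrightarrow> least_term f X (e \<mu>) (\<tau> \<mu>)" by metis
  have "finite K'" "K' \<subseteq> K" using finite_generators by (auto simp: K'_def)
  have "\<forall>C. \<exists>t. C \<subseteq> K' \<longrightarrow> t \<in> lat_terms X \<and> (\<forall>u. lat_le t u \<longleftrightarrow> (\<forall>\<mu>\<in>C. lat_le (\<tau> \<mu>) u)) \<and>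
      (\<forall>a\<in>carrier L. lat_eval L f t \<sqsubseteq> a \<longleftrightarrow> (\<forall>\<mu>\<in>C. lat_eval L f (\<tau> \<mu>) \<sqsubseteq> a))"
  proof (intro allI)
    fix C
    show "\<exists>t. C \<subseteq> K' \<longrightarrow> t \<in> lat_terms X \<and> (\<forall>u. lat_le t u \<longleftrightarrow> (\<forall>\<mu>\<in>C. lat_le (\<tau> \<mu>) u)) \<and>
      (\<forall>a\<in>carrier L. lat_eval L f t \<sqsubseteq> a \<longleftrightarrow> (\<forall>\<mu>\<in>C. lat_eval L f (\<tau> \<mu>) \<sqsubseteq> a))"
    proof (cases "C \<subseteq> K'")
      case True
      then have "finite C" "\<tau> ` C \<subseteq> lat_terms X"
        using \<open>finite K'\<close> \<tau> by (auto simp: least_term_def intro: finite_subset)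
      from finite_Join_term[where f = f and \<tau> = \<tau>, OF bounded_lattice_L f this] show ?thesis by blast
    qed simp
  qed
  from choice[OF this] obtain \<sigma> where
      "\<forall>C. C \<subseteq> K' \<longrightarrow> \<sigma> C \<in> lat_terms X \<and>
        (\<forall>u. lat_le (\<sigma> C) u \<longleftrightarrow> (\<forall>\<mu>\<in>C. lat_le (\<tau> \<mu>) u)) \<and>
        (\<forall>a\<in>carrier L. lat_eval L f (\<sigma> C) \<sqsubseteq> a \<longleftrightarrow> (\<forall>\<mu>\<in>C. lat_eval L f (\<tau> \<mu>) \<sqsubseteq> a))" ..
  then have \<sigma>: "\<And>C. C \<subseteq> K' \<Longrightarrow> \<sigma> C \<in> lat_terms X"
      "\<And>C u. C \<subseteq> K' \<Longrightarrow> lat_le (\<sigma> C) u \<longleftrightarrow> (\<forall>\<mu>\<in>C. lat_le (\<tau> \<mu>) u)"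
      "\<And>C a. C \<subseteq> K' \<Longrightarrow> a \<in> carrier L \<Longrightarrow>
        lat_eval L f (\<sigma> C) \<sqsubseteq> a \<longleftrightarrow> (\<forall>\<mu>\<in>C. lat_eval L f (\<tau> \<mu>) \<sqsubseteq> a)"
    by blast+
  \<comment> \<open>The guard keeps the value of the meet above the generator.\<close>
  define T where "T = Gen ` {x\<in>X. e \<kappa> \<sqsubseteq> f x} \<union> \<sigma> ` {C. C \<subseteq> K' \<and> e \<kappa> \<sqsubseteq> lat_eval L f (\<sigma> C)}"
  have "finite T" "(\<lambda>t. t) ` T \<subseteq> lat_terms X"
  proof -
    have "finite {C. C \<subseteq> K' \<and> e \<kappa> \<sqsubseteq> lat_eval L f (\<sigma> C)}"
      by (rule finite_subset[OF _ finite_Pow_iff[THEN iffD2, OF \<open>finite K'\<close>]]) blast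
    then show "finite T" using X by (simp add: T_def)
  qed (use \<sigma>(1) in \<open>auto simp: T_def\<close>)
  from finite_Meet_term[where f = f and \<tau> = "\<lambda>t. t", OF bounded_lattice_L f this] obtain m where
      m: "m \<in> lat_terms X" "\<forall>u. lat_le u m \<longleftrightarrow> (\<forall>t\<in>T. lat_le u t)"
      "\<forall>a\<in>carrier L. a \<sqsubseteq> lat_eval L f m \<longleftrightarrow> (\<forall>t\<in>T. a \<sqsubseteq> lat_eval L f t)"
    by (elim bexE conjE) (rule that)
  have m_le: "lat_le m t" if "t \<in> T" for t using m(2)[rule_format, of m] that lat_le.refl by blast
  have "e \<kappa> \<sqsubseteq> lat_eval L f m"
    unfolding m(3)[rule_format, OF generator_closed[OF less.prems]] by (auto simp: T_def)
  moreover have "lat_le m s" if "s \<in> lat_terms X" "e \<kappa> \<sqsubseteq> lat_eval L f s" for s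
    using that
  proof (induction s)
    case (Gen x)
    then show ?case by (intro m_le) (auto simp: T_def)
  next
    case Bot
    then show ?case using generator_not_bottom[OF less.prems] by simp
  next
    case Top
    show ?case by (rule lat_le.top)
  next
    case (Meet s t)
    then have "e \<kappa> \<sqsubseteq> lat_eval L f s" "e \<kappa> \<sqsubseteq> lat_eval L f t"
      using generator_closed[OF less.prems] closed by (simp_all add: le_meet_iff)
    with Meet show ?case by (simp add: lat_le_Meet_iff)
  next
    case (Join s t)
    consider "e \<kappa> \<sqsubseteq> lat_eval L f s" | "e \<kappa> \<sqsubseteq> lat_eval L f t"
      | "\<not> e \<kappa> \<sqsubseteq> lat_eval L f s" "\<not> e \<kappa> \<sqsubseteq> lat_eval L f t" by blast
    then show ?case
    proof cases
      case 1
      then show ?thesis using Join by (intro lat_le.trans[OF _ lat_le.join_left]) simp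
    next
      case 2
      then show ?thesis using Join by (intro lat_le.trans[OF _ lat_le.join_right]) simp
    next
      case 3
      define C where "C = {\<mu>\<in>K'. e \<mu> \<sqsubseteq> lat_eval L f s \<or> e \<mu> \<sqsubseteq> lat_eval L f t}"
      have C: "C \<subseteq> K'" by (auto simp: C_def)
      have "e \<mu> \<sqsubseteq> lat_eval L f (\<sigma> C)" if "\<mu> \<in> C" for \<mu>
      proof -
        have "lat_eval L f (\<tau> \<mu>) \<sqsubseteq> lat_eval L f (\<sigma> C)"
          using \<sigma>(3)[OF C closed, of "\<sigma> C"] that le_refl[OF closed] by blast
        moreover have "e \<mu> \<sqsubseteq> lat_eval L f (\<tau> \<mu>)" "\<mu> \<in> K"
          using \<tau> that C \<open>K' \<subseteq> K\<close> by (auto simp: least_term_def)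
        ultimately show ?thesis using le_trans[OF _ _ generator_closed closed closed] by blast
      qed
      then have "e \<kappa> \<sqsubseteq> lat_eval L f (\<sigma> C)"
        using refine_cover[OF less.prems closed closed closed, of s t "\<sigma> C"] 3 Join.prems
        by (auto simp: C_def K'_def)
      then have "lat_le m (\<sigma> C)" using C by (intro m_le) (auto simp: T_def)
      moreover have "lat_le (\<tau> \<mu>) (Join s t)" if "\<mu> \<in> C" for \<mu>
      proof -
        have "lat_le (\<tau> \<mu>) s \<or> lat_le (\<tau> \<mu>) t"
          using that \<tau>[of \<mu>] Join.prems(1) by (auto simp: C_def least_term_def)
        then show ?thesis
          using lat_le.trans[OF _ lat_le.join_left] lat_le.trans[OF _ lat_le.join_right] by blast
      qed
      then have "lat_le (\<sigma> C) (Join s t)" using \<sigma>(2)[OF C] by blast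
      ultimately show ?thesis by (rule lat_le.trans)
    qed
  qed
  ultimately show ?case using m(1) by (intro exI[of _ m]) (simp add: least_term_def)
qed

text \<open>By density, the join of the least terms for the generators below \<open>a\<close> has a value above \<open>a\<close>.\<close>

theorem least_term_exists:
  assumes X: "finite X" and f: "\<And>x. f x \<in> carrier L" and a: "a \<in> carrier L"
  shows "\<exists>t\<in>lat_terms X. \<forall>s\<in>lat_terms X. a \<sqsubseteq> lat_eval L f s \<longleftrightarrow> lat_le t s"
proof -
  note closed = lat_eval_closed[where f = f, OF bounded_lattice_L f]
  define C where "C = {\<kappa>\<in>K. e \<kappa> \<sqsubseteq> a}"
  obtain \<tau> where \<tau>: "\<And>\<kappa>. \<kappa> \<in> C \<Longrightarrow> least_term f X (e \<kappa>) (\<tau> \<kappa>)"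
    using least_term_generator[where f = f, OF X f] unfolding C_def
    by (metis (no_types, lifting) mem_Collect_eq)
  have "finite C" "\<tau> ` C \<subseteq> lat_terms X"
    using finite_generators \<tau> by (auto simp: least_term_def C_def)
  from finite_Join_term[where f = f and \<tau> = \<tau>, OF bounded_lattice_L f this] obtain t where t: "t \<in> lat_terms X"
      "\<And>u. lat_le t u \<longleftrightarrow> (\<forall>\<kappa>\<in>C. lat_le (\<tau> \<kappa>) u)"
      "\<And>a. a \<in> carrier L \<Longrightarrow> lat_eval L f t \<sqsubseteq> a \<longleftrightarrow> (\<forall>\<kappa>\<in>C. lat_eval L f (\<tau> \<kappa>) \<sqsubseteq> a)"
    by blast
  have "a \<sqsubseteq> lat_eval L f t"
  proof (rule generators_dense[OF a closed])
    fix \<kappa> assume \<kappa>: "\<kappa> \<in> K" "e \<kappa> \<sqsubseteq> a"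
    then have "lat_eval L f (\<tau> \<kappa>) \<sqsubseteq> lat_eval L f t" "e \<kappa> \<sqsubseteq> lat_eval L f (\<tau> \<kappa>)"
      using t(3)[OF closed, of t] le_refl[OF closed] \<tau>[of \<kappa>] by (auto simp: C_def least_term_def)
    then show "e \<kappa> \<sqsubseteq> lat_eval L f t"
      using le_trans[OF _ _ generator_closed[OF \<kappa>(1)] closed closed] by blast
  qed
  then have "a \<sqsubseteq> lat_eval L f s \<longleftrightarrow> lat_le t s" if s: "s \<in> lat_terms X" for s
  proof safe
    assume "a \<sqsubseteq> lat_eval L f s"
    then have "e \<kappa> \<sqsubseteq> lat_eval L f s" if "\<kappa> \<in> C" for \<kappa>
      using that le_trans[OF _ _ generator_closed a closed] by (auto simp: C_def)
    with \<tau> s show "lat_le t s" by (auto simp: t(2) least_term_def)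
  next
    assume "a \<sqsubseteq> lat_eval L f t" "lat_le t s"
    then show "a \<sqsubseteq> lat_eval L f s"
      using lat_eval_mono[where f = f, OF bounded_lattice_L f] le_trans[OF _ _ a closed closed] by blast
  qed
  with t(1) show ?thesis by blast
qed

end


section \<open>Self-dual lattices\<close>

primrec dual_term :: "'x lat_term \<Rightarrow> 'x lat_term" where
  "dual_term (Gen x) = Gen x"
| "dual_term Bot = Top"
| "dual_term Top = Bot"
| "dual_term (Meet s t) = Join (dual_term s) (dual_term t)"
| "dual_term (Join s t) = Meet (dual_term s) (dual_term t)"

lemma dual_dual_term [simp]: "dual_term (dual_term t) = t"
  by (induction t) auto

lemma dual_term_in_lat_terms [simp]: "dual_term t \<in> lat_terms X \<longleftrightarrow> t \<in> lat_terms X"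
  by (induction t) auto

lemma lat_le_dual_term: "lat_le s t \<Longrightarrow> lat_le (dual_term t) (dual_term s)"
  by (induction rule: lat_le.induct) (auto intro: lat_le.intros)

lemma lat_le_dual_term_iff: "lat_le (dual_term t) (dual_term s) \<longleftrightarrow> lat_le s t"
  by (metis dual_dual_term lat_le_dual_term)

locale self_dual_lattice = bounded_lattice L for L :: "'a gorder" (structure) +
  fixes \<delta> :: "'a \<Rightarrow> 'a"
  assumes dual_closed: "a \<in> carrier L \<Longrightarrow> \<delta> a \<in> carrier L"
    and dual_dual: "a \<in> carrier L \<Longrightarrow> \<delta> (\<delta> a) = a"
    and dual_antimono: "\<lbrakk>a \<in> carrier L; b \<in> carrier L; a \<sqsubseteq> b\<rbrakk> \<Longrightarrow> \<delta> b \<sqsubseteq> \<delta> a"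
begin

declare le_antisym [rule del]

lemma bounded_lattice_self: "bounded_lattice L" by unfold_locales

lemma dual_le_iff: "\<lbrakk>a \<in> carrier L; b \<in> carrier L\<rbrakk> \<Longrightarrow> \<delta> b \<sqsubseteq> \<delta> a \<longleftrightarrow> a \<sqsubseteq> b"
  by (metis dual_antimono dual_closed dual_dual)

lemma dual_join:
  assumes "a \<in> carrier L" "b \<in> carrier L"
  shows "\<delta> (a \<squnion> b) = \<delta> a \<sqinter> \<delta> b"
proof (rule le_antisym)
  show "\<delta> (a \<squnion> b) \<sqsubseteq> \<delta> a \<sqinter> \<delta> b"
    using assms by (intro meet_le dual_antimono dual_closed join_left join_right join_closed)
  have closed: "\<delta> a \<in> carrier L" "\<delta> b \<in> carrier L" "\<delta> a \<sqinter> \<delta> b \<in> carrier L"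
    using assms by (simp_all add: dual_closed)
  have "a \<sqsubseteq> \<delta> (\<delta> a \<sqinter> \<delta> b)" "b \<sqsubseteq> \<delta> (\<delta> a \<sqinter> \<delta> b)"
    using dual_antimono[OF closed(3,1) meet_left] dual_antimono[OF closed(3,2) meet_right] closed assms
    by (simp_all add: dual_dual)
  then have "a \<squnion> b \<sqsubseteq> \<delta> (\<delta> a \<sqinter> \<delta> b)"
    using assms dual_closed[OF closed(3)] by (simp add: join_le_iff)
  then have "\<delta> (\<delta> (\<delta> a \<sqinter> \<delta> b)) \<sqsubseteq> \<delta> (a \<squnion> b)"
    using assms closed by (intro dual_antimono dual_closed join_closed)
  then show "\<delta> a \<sqinter> \<delta> b \<sqsubseteq> \<delta> (a \<squnion> b)" using closed by (simp add: dual_dual)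
qed (use assms in \<open>simp_all add: dual_closed\<close>)

lemma dual_meet:
  assumes "a \<in> carrier L" "b \<in> carrier L"
  shows "\<delta> (a \<sqinter> b) = \<delta> a \<squnion> \<delta> b"
proof -
  have "\<delta> (\<delta> a \<squnion> \<delta> b) = a \<sqinter> b" using assms by (simp add: dual_join dual_closed dual_dual)
  then show ?thesis using assms by (metis dual_closed dual_dual join_closed)
qed

lemma dual_bottom: "\<delta> \<bottom> = \<top>"
proof (rule top_eq)
  fix a assume a: "a \<in> carrier L"
  then have "\<delta> (\<delta> a) \<sqsubseteq> \<delta> \<bottom>" by (intro dual_antimono bottom_lower dual_closed bottom_closed)
  with a show "a \<sqsubseteq> \<delta> \<bottom>" by (simp add: dual_dual)
qed (intro dual_closed bottom_closed)

lemma dual_top: "\<delta> \<top> = \<bottom>"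
  by (metis bottom_closed dual_bottom dual_dual)

lemma lat_eval_dual_term:
  assumes f: "\<And>x. f x \<in> carrier L"
  shows "lat_eval L f (dual_term t) = \<delta> (lat_eval L (\<lambda>x. \<delta> (f x)) t)"
proof -
  have "\<And>x. \<delta> (f x) \<in> carrier L" by (intro dual_closed f)
  note closed = lat_eval_closed[where f = "\<lambda>x. \<delta> (f x)", OF bounded_lattice_self this]
  show ?thesis
    by (induction t) (auto simp: dual_dual f dual_bottom dual_top dual_join dual_meet closed)
qed

text \<open>
  The dual of the least term for \<open>\<delta> a\<close> under the valuation \<open>\<delta> \<circ> f\<close> is the greatest term for
  \<open>a\<close> under \<open>f\<close>; this is why least terms are demanded for every valuation.
\<close>

lemma greatest_term_exists:
  assumes least: "\<And>f a. (\<And>x. f x \<in> carrier L) \<Longrightarrow> a \<in> carrier L \<Longrightarrow>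
      \<exists>t\<in>lat_terms X. \<forall>s\<in>lat_terms X. a \<sqsubseteq> lat_eval L f s \<longleftrightarrow> lat_le t s"
    and f: "\<And>x. f x \<in> carrier L" and a: "a \<in> carrier L"
  shows "\<exists>t\<in>lat_terms X. \<forall>s\<in>lat_terms X. lat_eval L f s \<sqsubseteq> a \<longleftrightarrow> lat_le s t"
proof -
  have df: "\<And>x. \<delta> (f x) \<in> carrier L" by (intro dual_closed f)
  obtain t where t: "t \<in> lat_terms X"
      "\<And>s. s \<in> lat_terms X \<Longrightarrow> \<delta> a \<sqsubseteq> lat_eval L (\<lambda>x. \<delta> (f x)) s \<longleftrightarrow> lat_le t s"
    using least[of "\<lambda>x. \<delta> (f x)", OF df dual_closed[OF a]] by blast
  have "lat_eval L f s \<sqsubseteq> a \<longleftrightarrow> lat_le s (dual_term t)" if s: "s \<in> lat_terms X" for s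
  proof -
    have "lat_eval L f s = \<delta> (lat_eval L (\<lambda>x. \<delta> (f x)) (dual_term s))"
      using lat_eval_dual_term[where f = f, OF f, of "dual_term s"] by simp
    then have "lat_eval L f s \<sqsubseteq> a \<longleftrightarrow> \<delta> a \<sqsubseteq> lat_eval L (\<lambda>x. \<delta> (f x)) (dual_term s)"
      using a by (metis dual_closed dual_dual dual_le_iff
          lat_eval_closed[where f = "\<lambda>x. \<delta> (f x)", OF bounded_lattice_self df])
    also have "\<dots> \<longleftrightarrow> lat_le s (dual_term t)"
      using s by (metis t(2) dual_dual_term dual_term_in_lat_terms lat_le_dual_term_iff)
    finally show ?thesis .
  qed
  with t(1) show ?thesis by (intro bexI[of _ "dual_term t"]) auto
qed

end

text \<open>
  The valuation enumerates the carrier by an initial segment of the natural numbers, which makes the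
  homomorphism surjective; the classes of the least and greatest terms are the values of its adjoints.
\<close>

lemma mckenzie_boundedI:
  fixes L :: "'a gorder" (structure)
  assumes L: "bounded_lattice L" and fin: "finite (carrier L)"
    and least: "\<And>(X :: nat set) f a. finite X \<Longrightarrow> (\<And>x. f x \<in> carrier L) \<Longrightarrow> a \<in> carrier L \<Longrightarrow>
      \<exists>t\<in>lat_terms X. \<forall>s\<in>lat_terms X. a \<sqsubseteq>\<^bsub>L\<^esub> lat_eval L f s \<longleftrightarrow> lat_le t s"
    and greatest: "\<And>(X :: nat set) f a. finite X \<Longrightarrow> (\<And>x. f x \<in> carrier L) \<Longrightarrow> a \<in> carrier L \<Longrightarrow>
      \<exists>t\<in>lat_terms X. \<forall>s\<in>lat_terms X. lat_eval L f s \<sqsubseteq>\<^bsub>L\<^esub> a \<longleftrightarrow> lat_le s t"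
  shows "mckenzie_bounded L"
proof -
  interpret bounded_lattice L by fact
  note le_antisym [rule del]
  obtain g N where "carrier L = g ` {i::nat. i < N}"
    using finite_imp_nat_seg_image_inj_on[OF fin] by blast
  define X where "X = {i::nat. i < N}"
  have g: "carrier L = g ` X" unfolding X_def by fact
  have "finite X" by (simp add: X_def)
  define f where "f i = (if i \<in> X then g i else \<bottom>)" for i
  have f: "f i \<in> carrier L" for i using g by (auto simp: f_def)
  have "f ` X = g ` X" by (rule image_cong) (simp_all add: f_def)
  then have fX: "f ` X = carrier L" unfolding g .
  let ?F = "free_bounded_lattice X"
  obtain h where h: "h \<in> bounded_lattice_hom ?F L" and gen: "\<forall>x\<in>X. h (lat_class X (Gen x)) = f x"
    using free_bounded_lattice_universal[OF L, of f X] f by auto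
  have h_class: "h (lat_class X t) = lat_eval L f t" if "t \<in> lat_terms X" for t
    using that
  proof (induction t)
    case (Meet s t)
    then have "h (lat_class X s \<sqinter>\<^bsub>?F\<^esub> lat_class X t) = h (lat_class X s) \<sqinter> h (lat_class X t)"
      using h by (simp add: bounded_lattice_hom_def meet_pres_def lat_class_closed)
    with Meet show ?case by (simp add: meet_free)
  next
    case (Join s t)
    then have "h (lat_class X s \<squnion>\<^bsub>?F\<^esub> lat_class X t) = h (lat_class X s) \<squnion> h (lat_class X t)"
      using h by (simp add: bounded_lattice_hom_def join_pres_def lat_class_closed)
    with Join show ?case by (simp add: join_free)
  qed (use gen h in \<open>auto simp: bounded_lattice_hom_def bottom_free top_free\<close>)
  have h_closed: "h \<in> carrier ?F \<rightarrow> carrier L" using h by (simp add: bounded_lattice_hom_def)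
  have po: "partial_order L" "partial_order ?F"
    by (simp_all add: partial_order_axioms partial_order_free)
  have "h ` carrier ?F = carrier L"
  proof
    show "h ` carrier ?F \<subseteq> carrier L" using h_closed by auto
    show "carrier L \<subseteq> h ` carrier ?F"
    proof
      fix a assume "a \<in> carrier L"
      then obtain x where "x \<in> X" "a = f x" using fX by blast
      then show "a \<in> h ` carrier ?F"
        using gen by (intro image_eqI[of _ _ "lat_class X (Gen x)"]) (auto simp: lat_class_closed)
    qed
  qed
  moreover have "upper_adjoint L ?F h"
  proof -
    obtain \<beta> where \<beta>: "\<And>a. a \<in> carrier L \<Longrightarrow> \<beta> a \<in> lat_terms X"
      "\<And>a s. a \<in> carrier L \<Longrightarrow> s \<in> lat_terms X \<Longrightarrow> a \<sqsubseteq> lat_eval L f s \<longleftrightarrow> lat_le (\<beta> a) s"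
      using least[where f = f, OF \<open>finite X\<close> f] by metis
    have "lat_class X (\<beta> a) \<sqsubseteq>\<^bsub>?F\<^esub> A \<longleftrightarrow> a \<sqsubseteq> h A" if "a \<in> carrier L" "A \<in> carrier ?F" for a A
      using that(2) by (rule free_cases) (simp add: that(1) \<beta> h_class le_free)
    then have "galois_connection
        \<lparr>orderA = L, orderB = ?F, lower = \<lambda>a. lat_class X (\<beta> a), upper = h\<rparr>"
      using po h_closed \<beta>(1)
      by (auto simp: galois_connection_def connection_def galois_connection_axioms_def lat_class_closed)
    then show ?thesis unfolding upper_adjoint_def by blast
  qed
  moreover have "lower_adjoint ?F L h"
  proof -
    obtain \<alpha> where \<alpha>: "\<And>a. a \<in> carrier L \<Longrightarrow> \<alpha> a \<in> lat_terms X"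
      "\<And>a s. a \<in> carrier L \<Longrightarrow> s \<in> lat_terms X \<Longrightarrow> lat_eval L f s \<sqsubseteq> a \<longleftrightarrow> lat_le s (\<alpha> a)"
      using greatest[where f = f, OF \<open>finite X\<close> f] by metis
    have "h A \<sqsubseteq> a \<longleftrightarrow> A \<sqsubseteq>\<^bsub>?F\<^esub> lat_class X (\<alpha> a)" if "a \<in> carrier L" "A \<in> carrier ?F" for a A
      using that(2) by (rule free_cases) (simp add: that(1) \<alpha> h_class le_free)
    then have "galois_connection
        \<lparr>orderA = ?F, orderB = L, lower = h, upper = \<lambda>a. lat_class X (\<alpha> a)\<rparr>"
      using po h_closed \<alpha>(1)
      by (auto simp: galois_connection_def connection_def galois_connection_axioms_def lat_class_closed)
    then show ?thesis unfolding lower_adjoint_def by blast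
  qed
  ultimately show ?thesis
    unfolding mckenzie_bounded_def using fin lattice_axioms \<open>finite X\<close> h by blast
qed


section \<open>Inversion sets\<close>

primrec precedence :: "'a list \<Rightarrow> 'a rel" where
  "precedence [] = {}"
| "precedence (x # xs) = {x} \<times> set xs \<union> precedence xs"

text \<open>
  An inversion is written with its smaller member first, although the larger one comes first in the list.
\<close>

definition inversions :: "'a::linorder list \<Rightarrow> 'a rel" where
  "inversions xs = {(x, y). x < y \<and> (y, x) \<in> precedence xs}"

text \<open>
  The last conjunct says that the complement of \<open>I\<close> in the strict order on \<open>A\<close> is transitive as well.
\<close>

definition biclosed :: "'a::linorder set \<Rightarrow> 'a rel \<Rightarrow> bool" where
  "biclosed A I \<longleftrightarrow> I \<subseteq> {(x, y). x \<in> A \<and> y \<in> A \<and> x < y} \<and> trans I \<and>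
     (\<forall>x y z. (x, z) \<in> I \<longrightarrow> y \<in> A \<longrightarrow> x < y \<longrightarrow> y < z \<longrightarrow> (x, y) \<in> I \<or> (y, z) \<in> I)"

lemma precedence_append:
  "precedence (xs @ ys) = precedence xs \<union> set xs \<times> set ys \<union> precedence ys"
  by (induction xs) auto

lemma precedence_set: "(x, y) \<in> precedence xs \<Longrightarrow> x \<in> set xs \<and> y \<in> set xs"
  by (induction xs) auto

lemma precedence_total:
  "\<lbrakk>x \<in> set xs; y \<in> set xs; x \<noteq> y\<rbrakk> \<Longrightarrow> (x, y) \<in> precedence xs \<or> (y, x) \<in> precedence xs"
  by (induction xs) auto

lemma precedence_asym: "\<lbrakk>distinct xs; (x, y) \<in> precedence xs\<rbrakk> \<Longrightarrow> (y, x) \<notin> precedence xs"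
  by (induction xs) (auto dest: precedence_set)

lemma precedence_trans:
  "\<lbrakk>distinct xs; (x, y) \<in> precedence xs; (y, z) \<in> precedence xs\<rbrakk> \<Longrightarrow> (x, z) \<in> precedence xs"
  by (induction xs) (auto dest: precedence_set)

lemma biclosedD:
  assumes "biclosed A I"
  shows "(x, y) \<in> I \<Longrightarrow> x \<in> A" "(x, y) \<in> I \<Longrightarrow> y \<in> A" "(x, y) \<in> I \<Longrightarrow> x < y"
    "(x, y) \<in> I \<Longrightarrow> (y, z) \<in> I \<Longrightarrow> (x, z) \<in> I"
    "(x, z) \<in> I \<Longrightarrow> y \<in> A \<Longrightarrow> x < y \<Longrightarrow> y < z \<Longrightarrow> (x, y) \<in> I \<or> (y, z) \<in> I"
  using assms unfolding biclosed_def by (blast dest: transD)+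

lemma biclosed_inversions:
  assumes "distinct xs"
  shows "biclosed (set xs) (inversions xs)"
  unfolding biclosed_def
proof (intro conjI allI impI)
  show "inversions xs \<subseteq> {(x, y). x \<in> set xs \<and> y \<in> set xs \<and> x < y}"
    by (auto simp: inversions_def dest: precedence_set)
  show "trans (inversions xs)"
    by (rule transI) (auto simp: inversions_def intro: precedence_trans[OF assms])
  fix x y z
  assume xz: "(x, z) \<in> inversions xs" and y: "y \<in> set xs" "x < y" "y < z"
  then have "x \<in> set xs" "z \<in> set xs" by (auto simp: inversions_def dest: precedence_set)
  with y have "(x, y) \<in> precedence xs \<or> (y, x) \<in> precedence xs"
    "(y, z) \<in> precedence xs \<or> (z, y) \<in> precedence xs"
    using precedence_total by (metis less_irrefl)+
  moreover have "\<not> ((x, y) \<in> precedence xs \<and> (y, z) \<in> precedence xs)"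
    using xz precedence_trans[OF assms, of x y z] precedence_asym[OF assms, of x z]
    by (auto simp: inversions_def)
  ultimately show "(x, y) \<in> inversions xs \<or> (y, z) \<in> inversions xs"
    using y by (auto simp: inversions_def)
qed

lemma linear_arrangement:
  assumes "finite A" "asymp_on A R" "transp_on A R" "totalp_on A R"
  shows "\<exists>xs. distinct xs \<and> set xs = A \<and> (\<forall>(x, y)\<in>precedence xs. R x y)"
  using assms
proof (induction A rule: finite_psubset_induct)
  case (psubset A)
  show ?case
  proof (cases "A = {}")
    case False
    obtain m where m: "m \<in> A" "\<forall>x\<in>A. x \<noteq> m \<longrightarrow> \<not> R x m"
      using Finite_Set.bex_min_element[OF psubset.hyps psubset.prems(1,2) False] by blast
    have "A - {m} \<subset> A" using m(1) by auto
    moreover have "asymp_on (A - {m}) R" "transp_on (A - {m}) R" "totalp_on (A - {m}) R"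
      using psubset.prems by (auto intro: asymp_on_subset transp_on_subset totalp_on_subset)
    ultimately obtain xs where xs: "distinct xs" "set xs = A - {m}" "\<forall>(x, y)\<in>precedence xs. R x y"
      using psubset.IH by blast
    have "R m x" if "x \<in> set xs" for x
      using that m xs(2) psubset.prems(3) by (auto simp: totalp_on_def)
    then show ?thesis using xs m by (intro exI[of _ "m # xs"]) auto
  qed simp
qed

text \<open>
  Reversing the given order exactly on \<open>I\<close> yields a tournament on \<open>A\<close>; transitivity of \<open>I\<close> and of its
  complement are together what makes it transitive, hence a linear order.
\<close>

lemma biclosed_imp_inversions:
  assumes A: "finite A" and I: "biclosed A I"
  shows "\<exists>xs. distinct xs \<and> set xs = A \<and> inversions xs = I"
proof -
  note I = biclosedD[OF I]
  define R where "R x y \<longleftrightarrow> x < y \<and> (x, y) \<notin> I \<or> y < x \<and> (y, x) \<in> I" for x y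
  have "asymp_on A R" by (auto simp: asymp_on_def R_def)
  moreover have "totalp_on A R" by (auto simp: totalp_on_def R_def)
  moreover have "transp_on A R"
  proof (rule transp_onI)
    fix x y z
    assume A: "x \<in> A" "y \<in> A" "z \<in> A" and R: "R x y" "R y z"
    then have "x \<noteq> z" by (auto simp: R_def)
    then consider "x < z" | "z < x" by force
    then show "R x z"
    proof cases
      case 1
      have "(x, z) \<notin> I"
        using R I(4)[of x z y] I(4)[of y x z] I(5)[of x z y] I(3)[of x y] I(3)[of y z] A(2)
        unfolding R_def by auto
      with 1 show ?thesis by (simp add: R_def)
    next
      case 2
      have "(z, x) \<in> I"
        using R 2 I(4)[of z y x] I(5)[of y x z] I(5)[of z y x] A unfolding R_def by auto
      with 2 show ?thesis by (simp add: R_def)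
    qed
  qed
  ultimately obtain xs where xs: "distinct xs" "set xs = A" "\<forall>(x, y)\<in>precedence xs. R x y"
    using linear_arrangement[OF A] by blast
  have "inversions xs = I"
  proof (intro equalityI subrelI)
    fix x y assume "(x, y) \<in> inversions xs"
    then show "(x, y) \<in> I" using xs(3) by (auto simp: inversions_def R_def)
  next
    fix x y assume xy: "(x, y) \<in> I"
    then have "(x, y) \<notin> precedence xs" using xs(3) I(3)[OF xy] by (auto simp: R_def)
    then show "(x, y) \<in> inversions xs"
      using precedence_total[of x xs y] I(1-3)[OF xy] xs(2) by (auto simp: inversions_def)
  qed
  with xs show ?thesis by blast
qed

text \<open>
  If \<open>x < y < z\<close> and a chain of pairs leads from \<open>x\<close> to \<open>z\<close>, then \<open>y\<close> is a point of the chain or is jumped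
  over by one of its pairs; co-transitivity of the relation containing that pair splits it at \<open>y\<close>.
\<close>

lemma biclosed_trancl_Un:
  assumes B: "biclosed A B" and C: "biclosed A C"
  shows "biclosed A ((B \<union> C)\<^sup>+)"
proof -
  have sub: "B \<union> C \<subseteq> {(x, y). x \<in> A \<and> y \<in> A \<and> x < y}"
    using B C by (auto simp: biclosed_def)
  have "trans {(x, y). x \<in> A \<and> y \<in> A \<and> x < y}" by (auto intro: transI)
  then have "(B \<union> C)\<^sup>+ \<subseteq> {(x, y). x \<in> A \<and> y \<in> A \<and> x < y}"
    using trancl_mono[OF _ sub] trancl_id by blast
  moreover have "(x, y) \<in> (B \<union> C)\<^sup>+ \<or> (y, z) \<in> (B \<union> C)\<^sup>+"
    if "(x, z) \<in> (B \<union> C)\<^sup>+" "y \<in> A" "x < y" "y < z" for x y z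
    using that
  proof (induction rule: trancl_induct)
    case (base z)
    then have "(x, y) \<in> B \<union> C \<or> (y, z) \<in> B \<union> C" using biclosedD(5)[OF B] biclosedD(5)[OF C] by blast
    then show ?case by blast
  next
    case (step t z)
    consider "y < t" | "y = t" | "t < y" by force
    then show ?case
    proof cases
      case 1
      with step show ?thesis by (meson r_into_trancl trancl_into_trancl)
    next
      case 2
      with step show ?thesis by simp
    next
      case 3
      then have "(t, y) \<in> B \<union> C \<or> (y, z) \<in> B \<union> C"
        using step biclosedD(5)[OF B] biclosedD(5)[OF C] by blast
      with step.hyps(1) show ?thesis by (meson r_into_trancl trancl_into_trancl)
    qed
  qed
  ultimately show ?thesis by (auto simp: biclosed_def)
qed


section \<open>Arcs\<close>

text \<open>
  The elements from \<open>p\<close> to \<open>q\<close> outside \<open>V\<close> are moved behind those in \<open>V\<close>. For \<open>p \<notin> V\<close> and \<open>q \<in> V\<close> these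
  are the inversion sets of the permutations with exactly one descent, the join-irreducible elements of
  the weak order; \<open>(p, q)\<close> is the descent.
\<close>

definition arc :: "'a::linorder set \<Rightarrow> 'a \<Rightarrow> 'a \<Rightarrow> 'a set \<Rightarrow> 'a rel" where
  "arc A p q V = {(x, y). x \<in> A \<and> y \<in> A \<and> p \<le> x \<and> x < y \<and> y \<le> q \<and> x \<notin> V \<and> y \<in> V}"

text \<open>
  No pair of an arc starts where another one ends, so transitivity is vacuous; an element between the
  members of a pair lies in \<open>V\<close> or not, which decides on which side the pair is inherited.
\<close>

lemma biclosed_arc: "biclosed A (arc A p q V)"
  unfolding biclosed_def by (auto simp: arc_def trans_def)

text \<open>
  Put into \<open>V\<close> everything that is inverted with \<open>x\<close>: an \<open>s\<close> between \<open>x\<close> and \<open>t \<in> V\<close> that is not inverted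
  with \<open>x\<close> must be inverted with \<open>t\<close>, by co-transitivity.
\<close>

lemma arc_below_inversion:
  assumes B: "biclosed A B" and xy: "(x, y) \<in> B"
  shows "\<exists>V. V \<subseteq> A \<and> x \<notin> V \<and> y \<in> V \<and> arc A x y V \<subseteq> B"
proof (intro exI conjI)
  note B' = biclosedD[OF B]
  let ?V = "{r. (x, r) \<in> B}"
  show "?V \<subseteq> A" "x \<notin> ?V" "y \<in> ?V" using B'(2,3) xy by auto
  show "arc A x y ?V \<subseteq> B"
  proof
    fix st assume st: "st \<in> arc A x y ?V"
    obtain s t where [simp]: "st = (s, t)" by force
    have "s \<in> A" "x \<le> s" "s < t" "(x, s) \<notin> B" "(x, t) \<in> B" using st by (auto simp: arc_def)
    then show "st \<in> B" using B'(5)[of x t s] by (cases "x = s") auto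
  qed
qed

text \<open>
  A chain of pairs in \<open>B \<union> C\<close> from \<open>x\<close> to \<open>y\<close> with \<open>p \<le> x\<close> and \<open>y \<le> q\<close> can use the pair \<open>(p, q)\<close> only if it
  consists of it; all other pairs are short. So only \<open>(p, q)\<close> itself needs an argument, and it needs one
  only if it belongs to \<open>B\<close> or \<open>C\<close>.
\<close>

lemma short_inversions_generate_arc:
  assumes B: "biclosed A B" and C: "biclosed A C" and U: "trans U"
    and pq: "p \<in> A" "q \<in> A" "p < q" "p \<notin> V" "q \<in> V"
    and below: "arc A p q V \<subseteq> (B \<union> C)\<^sup>+"
    and not_below: "\<not> arc A p q V \<subseteq> B" "\<not> arc A p q V \<subseteq> C"
    and short: "\<And>x y. \<lbrakk>(x, y) \<in> B \<union> C; p \<le> x; y \<le> q; (x, y) \<noteq> (p, q)\<rbrakk> \<Longrightarrow> (x, y) \<in> U"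
  shows "arc A p q V \<subseteq> U"
proof -
  note B' = biclosedD[OF B] and C' = biclosedD[OF C]
  note BC' = biclosedD[OF biclosed_trancl_Un[OF B C]]
  have path: "(x, y) \<in> U \<or> (x, y) = (p, q) \<and> (p, q) \<in> B \<union> C"
    if "(x, y) \<in> (B \<union> C)\<^sup>+" "p \<le> x" "y \<le> q" for x y
    using that
  proof (induction rule: trancl_induct)
    case (base y)
    then show ?case using short by blast
  next
    case (step t y)
    have "x < t" "t < y" using BC'(3) step.hyps by auto
    then have "t \<noteq> p" "t \<noteq> q" "p \<le> t" "t \<le> q" using step.prems by auto
    then have "(x, t) \<in> U" "(t, y) \<in> U" using step short[of t y] by auto
    then show ?case using U by (blast dest: transD)
  qed
  have proper: "(x, y) \<in> U" if "(x, y) \<in> arc A p q V" "(x, y) \<noteq> (p, q)" for x y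
    using path[of x y] that below by (auto simp: arc_def)
  \<comment> \<open>Split \<open>(p, q)\<close> at an end point of a pair of the arc that is missing from \<open>D\<close>: one half is in the
      arc, because the point is on the right side of the partition, the other one is in \<open>D\<close>.\<close>
  have through: "(p, q) \<in> U"
    if D: "biclosed A D" "D \<subseteq> B \<union> C" "(p, q) \<in> D" "\<not> arc A p q V \<subseteq> D" for D
  proof -
    obtain x y where xy: "(x, y) \<in> arc A p q V" "(x, y) \<notin> D" using D(4) by auto
    then have xy': "x \<in> A" "y \<in> A" "p \<le> x" "x < y" "y \<le> q" "x \<notin> V" "y \<in> V"
      by (auto simp: arc_def)
    have shortD: "(s, t) \<in> U" if "(s, t) \<in> D" "p \<le> s" "t \<le> q" "(s, t) \<noteq> (p, q)" for s t
      using short that D(2) by blast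
    note D' = biclosedD(5)[OF D(1)]
    have xq: "(x, q) \<in> U" if "p < x"
      using that xy' pq by (intro proper) (auto simp: arc_def)
    have py: "(p, y) \<in> U" if "y < q"
      using that xy' pq by (intro proper) (auto simp: arc_def)
    have via_x: ?thesis if "p < x" "(p, x) \<in> D"
    proof -
      have "(p, x) \<in> U" using that xy' by (intro shortD) auto
      then show ?thesis using transD[OF U] xq that(1) by blast
    qed
    have via_y: ?thesis if "y < q" "(y, q) \<in> D"
    proof -
      have "(y, q) \<in> U" using that xy' by (intro shortD) auto
      then show ?thesis using transD[OF U] py that(1) by blast
    qed
    consider "x = p" | "y = q" | "p < x" "y < q" using xy' by force
    then show ?thesis
    proof cases
      case 1
      then have "y < q" "(p, y) \<notin> D" using xy xy' D(3) by (auto simp: less_le)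
      then show ?thesis using D'[OF D(3), of y] xy' 1 via_y by auto
    next
      case 2
      then have "p < x" "(x, q) \<notin> D" using xy xy' D(3) by (auto simp: less_le)
      then show ?thesis using D'[OF D(3), of x] xy' 2 via_x by auto
    next
      case 3
      then have "(p, x) \<in> D \<or> (x, q) \<in> D" using D'[OF D(3), of x] xy' by auto
      then show ?thesis using D'[of x q y] 3 xy xy' via_x via_y by auto
    qed
  qed
  have "(p, q) \<in> (B \<union> C)\<^sup>+" using below pq by (auto simp: arc_def)
  then have "(p, q) \<in> U" using path[of p q] through[OF B] through[OF C] not_below by auto
  with proper show ?thesis by auto
qed


section \<open>Words and inversion sets\<close>

text \<open>
  The pair \<open>(i, k)\<close> stands for the copy number \<open>k\<close> of the letter \<open>i\<close>; \<open>c i\<close> is the number of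
  the next copy. Numbering the second part of a concatenation starts from the counts of the first.
\<close>

primrec copies_from :: "(nat \<Rightarrow> nat) \<Rightarrow> nat list \<Rightarrow> (nat \<times> nat) list" where
  "copies_from c [] = []"
| "copies_from c (i # w) = (i, c i) # copies_from (c(i := Suc (c i))) w"

definition word_inversions :: "nat list \<Rightarrow> (nat \<times> nat) rel" where
  "word_inversions w = inversions (copies_from (\<lambda>_. 0) w)"

definition letter_copies :: "nat \<Rightarrow> (nat \<Rightarrow> nat) \<Rightarrow> (nat \<times> nat) set" where
  "letter_copies n v = {(i, k). i \<in> {1..n} \<and> k < v i}"

lemma map_fst_copies_from [simp]: "map fst (copies_from c w) = w"
  by (induction w arbitrary: c) auto

lemma copies_from_append:
  "copies_from c (w @ u) = copies_from c w @ copies_from (\<lambda>i. c i + count_list w i) u"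
proof (induction w arbitrary: c)
  case (Cons i w)
  have "(\<lambda>j. (c(i := Suc (c i))) j + count_list w j) = (\<lambda>j. c j + count_list (i # w) j)"
    by (auto simp: fun_eq_iff)
  then show ?case by (simp only: append_Cons copies_from.simps Cons.IH)
qed simp

lemma set_copies_from: "set (copies_from c w) = {(i, k). c i \<le> k \<and> k < c i + count_list w i}"
  by (induction w arbitrary: c) (auto split: if_splits)

lemma distinct_copies_from: "distinct (copies_from c w)"
  by (induction w arbitrary: c) (auto simp: set_copies_from)

lemma precedence_copies_from:
  "((i, k), (i, l)) \<in> precedence (copies_from c w) \<Longrightarrow> k < l"
  by (induction w arbitrary: c) (auto simp: set_copies_from)

lemma inversions_copies_from:
  "(x, y) \<in> inversions (copies_from c w) \<Longrightarrow> fst x < fst y"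
  by (cases x; cases y) (auto simp: inversions_def le_less dest: precedence_copies_from)

text \<open>
  If no two copies of a letter are inverted, each letter meets its copies in increasing order, so
  that the numbering can be recovered from the letters alone.
\<close>

lemma copies_from_map_fst:
  assumes "distinct xs" "set xs = {(i, k). c i \<le> k \<and> k < d i}"
    "\<And>x y. (x, y) \<in> inversions xs \<Longrightarrow> fst x < fst y"
  shows "copies_from c (map fst xs) = xs"
  using assms
proof (induction xs arbitrary: c)
  case (Cons x xs)
  obtain i k where x: "x = (i, k)" by force
  have ik: "c i \<le> k" "k < d i" using Cons.prems(2) x by auto
  have "c i = k"
  proof (rule ccontr)
    assume "c i \<noteq> k"
    with ik have "(i, c i) \<in> set (x # xs)" unfolding Cons.prems(2) by simp
    with x \<open>c i \<noteq> k\<close> ik have "((i, c i), (i, k)) \<in> inversions (x # xs)"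
      by (auto simp: inversions_def)
    then show False using Cons.prems(3) by fastforce
  qed
  have "set xs = set (x # xs) - {x}" using Cons.prems(1) by auto
  also have "\<dots> = {(j, l). (c(i := Suc (c i))) j \<le> l \<and> l < d j}"
    unfolding Cons.prems(2) using x \<open>c i = k\<close> by (auto split: if_splits)
  finally have "copies_from (c(i := Suc (c i))) (map fst xs) = xs"
    using Cons.prems(1,3) by (intro Cons.IH) (auto simp: inversions_def)
  with x \<open>c i = k\<close> show ?case by simp
qed simp

text \<open>
  Swapping two different letters leaves the numbers of all copies unchanged, and the only pair whose
  precedence changes is the swapped one, which becomes an inversion.
\<close>

lemma swap_step_inversions:
  assumes "swap_step w u"
  shows "word_inversions w \<subseteq> word_inversions u"
proof -
  obtain w1 w2 i j where ij: "i < j" and w: "w = w1 @ [i, j] @ w2" and u: "u = w1 @ [j, i] @ w2"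
    using assms unfolding swap_step_def by blast
  define c where "c = count_list w1"
  define x y where "x = (i, c i)" and "y = (j, c j)"
  define s t where "s = copies_from (\<lambda>_. 0) w1" and "t = copies_from (c(i := Suc (c i), j := Suc (c j))) w2"
  have "copies_from (\<lambda>_. 0) w = s @ x # y # t" "copies_from (\<lambda>_. 0) u = s @ y # x # t"
    using ij by (simp_all add: w u copies_from_append c_def x_def y_def s_def t_def fun_upd_twist)
  moreover have "x < y" using ij by (simp add: x_def y_def)
  ultimately show ?thesis by (auto simp: word_inversions_def inversions_def precedence_append)
qed

lemma swap_steps_inversions: "swap_step\<^sup>*\<^sup>* w u \<Longrightarrow> word_inversions w \<subseteq> word_inversions u"
  by (induction rule: rtranclp_induct) (auto dest: swap_step_inversions)

lemma swap_step_Cons: "swap_step w u \<Longrightarrow> swap_step (i # w) (i # u)"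
  unfolding swap_step_def by (metis append_Cons)

lemma swap_steps_Cons: "swap_step\<^sup>*\<^sup>* w u \<Longrightarrow> swap_step\<^sup>*\<^sup>* (i # w) (i # u)"
  by (induction rule: rtranclp_induct) (auto intro: rtranclp.rtrancl_into_rtrancl swap_step_Cons)

lemma bubble_to_front:
  "(\<And>i. i \<in> set u \<Longrightarrow> i < j) \<Longrightarrow> swap_step\<^sup>*\<^sup>* (u @ j # w) (j # u @ w)"
proof (induction u)
  case (Cons i u)
  then have "swap_step\<^sup>*\<^sup>* (i # u @ j # w) (i # j # u @ w)" by (intro swap_steps_Cons) simp
  moreover have "swap_step (i # j # u @ w) (j # i # u @ w)"
    unfolding swap_step_def using Cons.prems
    by (intro exI[of _ "[]"] exI[of _ "u @ w"] exI[of _ i] exI[of _ j]) simp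
  ultimately show ?case by simp
qed simp

text \<open>
  The first element \<open>y\<close> of the target can be bubbled to the front of \<open>xs\<close>: an element \<open>a\<close> in front of it
  cannot be larger, since \<open>(y, a)\<close> would be an inversion of \<open>xs\<close> but not of the target; so \<open>(a, y)\<close> is an
  inversion of the target, and the letter of \<open>a\<close> is smaller than that of \<open>y\<close>.
\<close>

lemma swap_steps_if_inversions_subset:
  fixes xs ys :: "(nat \<times> 'b::linorder) list"
  assumes "distinct xs" "distinct ys" "set xs = set ys" "inversions xs \<subseteq> inversions ys"
    and "\<And>x y. (x, y) \<in> inversions ys \<Longrightarrow> fst x < fst y"
  shows "swap_step\<^sup>*\<^sup>* (map fst xs) (map fst ys)"
  using assms
proof (induction ys arbitrary: xs)
  case Nil
  have "xs = []" using Nil.prems(3) by simp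
  then show ?case by simp
next
  case (Cons y ys)
  have "y \<in> set xs" using Cons.prems(3) by simp
  then obtain as bs where xs: "xs = as @ y # bs" by (meson split_list)
  have "fst a < fst y" if a: "a \<in> set as" for a
  proof -
    have "a \<noteq> y" "(a, y) \<in> precedence xs" using a Cons.prems(1) by (auto simp: xs precedence_append)
    have "a \<in> set ys" using a Cons.prems(3) \<open>a \<noteq> y\<close> by (auto simp: xs)
    then have ya: "(y, a) \<in> precedence (y # ys)" by simp
    then have "(a, y) \<notin> precedence (y # ys)" by (rule precedence_asym[OF Cons.prems(2)])
    then have "\<not> y < a" using Cons.prems(4) \<open>(a, y) \<in> precedence xs\<close> by (auto simp: inversions_def)
    then have "(a, y) \<in> inversions (y # ys)" using ya \<open>a \<noteq> y\<close> by (auto simp: inversions_def)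
    then show ?thesis by (rule Cons.prems(5))
  qed
  then have "swap_step\<^sup>*\<^sup>* (map fst as @ fst y # map fst bs) (fst y # map fst as @ map fst bs)"
    by (intro bubble_to_front) auto
  moreover have "swap_step\<^sup>*\<^sup>* (map fst (as @ bs)) (map fst ys)"
  proof (rule Cons.IH)
    show "distinct (as @ bs)" "distinct ys" using Cons.prems(1,2) by (auto simp: xs)
    show "set (as @ bs) = set ys" using Cons.prems(1-3) by (auto simp: xs)
    show "inversions (as @ bs) \<subseteq> inversions ys"
    proof (rule subrelI)
      fix p q assume pq: "(p, q) \<in> inversions (as @ bs)"
      then have "(p, q) \<in> inversions xs" by (auto simp: xs inversions_def precedence_append)
      then have "(p, q) \<in> inversions (y # ys)" using Cons.prems(4) by blast
      moreover have "q \<noteq> y"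
        using pq Cons.prems(1) by (auto simp: xs inversions_def dest: precedence_set)
      ultimately show "(p, q) \<in> inversions ys" by (auto simp: inversions_def)
    qed
    show "fst p < fst q" if "(p, q) \<in> inversions ys" for p q
      using that by (intro Cons.prems(5)) (auto simp: inversions_def)
  qed
  then have "swap_step\<^sup>*\<^sup>* (fst y # map fst as @ map fst bs) (fst y # map fst ys)"
    using swap_steps_Cons by simp
  ultimately show ?case by (simp add: xs)
qed

lemma finite_letter_copies: "finite (letter_copies n v)"
proof (rule finite_subset)
  show "letter_copies n v \<subseteq> Sigma {1..n} (\<lambda>i. {..<v i})" by (auto simp: letter_copies_def)
qed simp

lemma set_copies_of_word:
  assumes "w \<in> multinomial_words n v"
  shows "set (copies_from (\<lambda>_. 0) w) = letter_copies n v"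
proof -
  have "count_list w i = (if i \<in> {1..n} then v i else 0)" for i
    using assms by (auto simp: multinomial_words_def intro!: count_notin)
  then show ?thesis by (auto simp: set_copies_from letter_copies_def split: if_splits)
qed

definition word_biclosed :: "nat \<Rightarrow> (nat \<Rightarrow> nat) \<Rightarrow> (nat \<times> nat) rel \<Rightarrow> bool" where
  "word_biclosed n v I \<longleftrightarrow> biclosed (letter_copies n v) I \<and> (\<forall>(x, y)\<in>I. fst x < fst y)"

lemma word_biclosed_inversions:
  assumes "w \<in> multinomial_words n v"
  shows "word_biclosed n v (word_inversions w)"
  using biclosed_inversions[OF distinct_copies_from, of "\<lambda>_. 0" w]
    inversions_copies_from[of _ _ "\<lambda>_. 0" w]
  by (auto simp: word_biclosed_def word_inversions_def set_copies_of_word[OF assms])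

lemma swap_steps_iff:
  assumes "w \<in> multinomial_words n v" "u \<in> multinomial_words n v"
  shows "swap_step\<^sup>*\<^sup>* w u \<longleftrightarrow> word_inversions w \<subseteq> word_inversions u"
proof
  assume "word_inversions w \<subseteq> word_inversions u"
  then show "swap_step\<^sup>*\<^sup>* w u"
    using swap_steps_if_inversions_subset[of "copies_from (\<lambda>_. 0) w" "copies_from (\<lambda>_. 0) u"]
      set_copies_of_word assms inversions_copies_from
    by (auto simp: distinct_copies_from word_inversions_def)
qed (rule swap_steps_inversions)

lemma word_with_inversions:
  assumes "word_biclosed n v I"
  shows "\<exists>w\<in>multinomial_words n v. word_inversions w = I"
proof -
  obtain xs where xs: "distinct xs" "set xs = letter_copies n v" "inversions xs = I"
    using biclosed_imp_inversions[OF finite_letter_copies, of n v I] assms by (auto simp: word_biclosed_def)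
  define w where "w = map fst xs"
  have "letter_copies n v = {(i, k). 0 \<le> k \<and> k < (if i \<in> {1..n} then v i else 0)}"
    by (auto simp: letter_copies_def split: if_splits)
  then have copies: "copies_from (\<lambda>_. 0) w = xs"
    using xs assms unfolding w_def by (intro copies_from_map_fst) (auto simp: word_biclosed_def)
  have "count_list w i = v i" if "i \<in> {1..n}" for i
  proof -
    have "{k. k < count_list w i} = {k. k < v i}"
      using set_copies_from[of "\<lambda>_. 0" w] that by (auto simp: copies xs(2) letter_copies_def)
    then show ?thesis by (metis card_Collect_less_nat)
  qed
  moreover have "set w \<subseteq> {1..n}" using xs(2) by (auto simp: w_def letter_copies_def)
  ultimately have "w \<in> multinomial_words n v" by (simp add: multinomial_words_def)
  with copies xs(3) show ?thesis by (auto simp: word_inversions_def)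
qed

lemma finite_multinomial_words: "finite (multinomial_words n v)"
proof (rule finite_subset)
  show "multinomial_words n v \<subseteq> {w. set w \<subseteq> {1..n} \<and> length w = (\<Sum>i\<in>{1..n}. v i)}"
  proof safe
    fix w assume "w \<in> multinomial_words n v"
    then have w: "set w \<subseteq> {1..n}" "\<forall>i\<in>{1..n}. count_list w i = v i"
      by (auto simp: multinomial_words_def)
    then show "length w = (\<Sum>i\<in>{1..n}. v i)"
      using sum_count_set[of w "{1..n}"] by simp
  qed (auto simp: multinomial_words_def)
qed (rule finite_lists_length_eq, simp)

text \<open>Every step makes the word lexicographically larger.\<close>

lemma swap_steps_antisym:
  assumes "swap_step\<^sup>*\<^sup>* w u" "swap_step\<^sup>*\<^sup>* u w"
  shows "w = u"
proof -
  let ?r = "{(i, j). i < (j::nat)}"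
  have step: "(w, u) \<in> lexord ?r" if "swap_step w u" for w u
    using that unfolding swap_step_def by (auto intro!: lexord_append_leftI)
  have trans: "trans (lexord ?r)" by (rule lexord_transI) (auto intro: transI)
  have steps: "w = u \<or> (w, u) \<in> lexord ?r" if "swap_step\<^sup>*\<^sup>* w u" for w u
    using that by (induction rule: rtranclp_induct) (auto dest!: step dest: transD[OF trans])
  have "(w, w) \<notin> lexord ?r" by (rule lexord_irreflexive) simp
  then show ?thesis using steps[OF assms(1)] steps[OF assms(2)] transD[OF trans] by blast
qed

lemma swap_step_rev: "swap_step w u \<Longrightarrow> swap_step (rev u) (rev w)"
proof -
  assume "swap_step w u"
  then obtain w1 w2 i j where "i < j" "w = w1 @ [i, j] @ w2" "u = w1 @ [j, i] @ w2"
    unfolding swap_step_def by blast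
  then show ?thesis
    unfolding swap_step_def by (intro exI[of _ "rev w2"] exI[of _ "rev w1"]) auto
qed

lemma swap_steps_rev: "swap_step\<^sup>*\<^sup>* w u \<Longrightarrow> swap_step\<^sup>*\<^sup>* (rev u) (rev w)"
  by (induction rule: rtranclp_induct) (auto intro: converse_rtranclp_into_rtranclp swap_step_rev)

lemma rev_in_multinomial_words: "w \<in> multinomial_words n v \<Longrightarrow> rev w \<in> multinomial_words n v"
  by (auto simp: multinomial_words_def)


section \<open>The lattice of words\<close>

lemma carrier_multinomial_lattice [simp]:
  "carrier (multinomial_lattice n v) = multinomial_words n v"
  by (simp add: multinomial_lattice_def)

lemma le_multinomial_lattice: "le (multinomial_lattice n v) = swap_step\<^sup>*\<^sup>*"
  by (simp add: multinomial_lattice_def)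

lemma le_iff_inversions:
  "\<lbrakk>w \<in> multinomial_words n v; u \<in> multinomial_words n v\<rbrakk>
    \<Longrightarrow> w \<sqsubseteq>\<^bsub>multinomial_lattice n v\<^esub> u \<longleftrightarrow> word_inversions w \<subseteq> word_inversions u"
  by (simp add: le_multinomial_lattice swap_steps_iff)

lemma partial_order_multinomial_lattice: "partial_order (multinomial_lattice n v)"
proof unfold_locales
  show "(.=\<^bsub>multinomial_lattice n v\<^esub>) = (=)" by (simp add: multinomial_lattice_def)
  then show "x .=\<^bsub>multinomial_lattice n v\<^esub> y"
    if "x \<sqsubseteq>\<^bsub>multinomial_lattice n v\<^esub> y" "y \<sqsubseteq>\<^bsub>multinomial_lattice n v\<^esub> x" for x y
    using that swap_steps_antisym by (simp add: le_multinomial_lattice)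
qed (auto simp: multinomial_lattice_def)

lemma word_biclosed_join:
  assumes "word_biclosed n v I" "word_biclosed n v J"
  shows "word_biclosed n v ((I \<union> J)\<^sup>+)"
proof -
  have sub: "I \<union> J \<subseteq> {(x, y). fst x < fst y}"
    using assms unfolding word_biclosed_def by blast
  have "trans {(x :: nat \<times> nat, y :: nat \<times> nat). fst x < fst y}" by (auto intro: transI)
  then have "(I \<union> J)\<^sup>+ \<subseteq> {(x, y). fst x < fst y}"
    using trancl_mono[OF _ sub] trancl_id by blast
  then show ?thesis
    using assms biclosed_trancl_Un unfolding word_biclosed_def by blast
qed

text \<open>
  The transitive closure of the union is the least transitive relation containing both inversion sets,
  and it is itself the inversion set of a word.
\<close>

lemma least_upper_bound_of_words:
  assumes w: "w \<in> multinomial_words n v" and u: "u \<in> multinomial_words n v"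
  shows "\<exists>z. least (multinomial_lattice n v) z (Upper (multinomial_lattice n v) {w, u}) \<and>
    word_inversions z = (word_inversions w \<union> word_inversions u)\<^sup>+"
proof -
  let ?M = "multinomial_lattice n v"
  obtain z where z: "z \<in> multinomial_words n v"
    "word_inversions z = (word_inversions w \<union> word_inversions u)\<^sup>+"
    using word_with_inversions word_biclosed_join word_biclosed_inversions w u by metis
  have "z \<in> Upper ?M {w, u}"
    using w u z by (auto simp: Upper_def le_iff_inversions)
  moreover have "z \<sqsubseteq>\<^bsub>?M\<^esub> y" if "y \<in> Upper ?M {w, u}" for y
  proof -
    have "y \<in> multinomial_words n v" "w \<sqsubseteq>\<^bsub>?M\<^esub> y" "u \<sqsubseteq>\<^bsub>?M\<^esub> y"
      using that w u by (simp_all add: Upper_def)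
    then have y: "y \<in> multinomial_words n v" "word_inversions w \<union> word_inversions u \<subseteq> word_inversions y"
      using w u by (simp_all add: le_iff_inversions)
    have "trans (word_inversions y)"
      using word_biclosed_inversions[OF y(1)] by (simp add: word_biclosed_def biclosed_def)
    then have "(word_inversions w \<union> word_inversions u)\<^sup>+ \<subseteq> word_inversions y"
      using trancl_mono[OF _ y(2)] trancl_id by blast
    then show ?thesis using z y by (simp add: le_iff_inversions)
  qed
  ultimately show ?thesis using z(2) by (auto simp: least_def Upper_def)
qed

lemma rev_le_iff:
  "rev w \<sqsubseteq>\<^bsub>multinomial_lattice n v\<^esub> rev u \<longleftrightarrow> u \<sqsubseteq>\<^bsub>multinomial_lattice n v\<^esub> w"
  unfolding le_multinomial_lattice using swap_steps_rev[of "rev w" "rev u"] swap_steps_rev[of u w]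
  by auto

text \<open>Word reversal carries upper bounds to lower bounds.\<close>

lemma greatest_lower_bound_of_words:
  assumes w: "w \<in> multinomial_words n v" and u: "u \<in> multinomial_words n v"
  shows "\<exists>z. greatest (multinomial_lattice n v) z (Lower (multinomial_lattice n v) {w, u})"
proof -
  let ?M = "multinomial_lattice n v"
  obtain z where z: "least ?M z (Upper ?M {rev w, rev u})"
    using least_upper_bound_of_words[OF w[THEN rev_in_multinomial_words] u[THEN rev_in_multinomial_words]]
    by blast
  have rev_le: "rev x \<sqsubseteq>\<^bsub>?M\<^esub> y \<longleftrightarrow> rev y \<sqsubseteq>\<^bsub>?M\<^esub> x" for x y
    using rev_le_iff[where w = x and u = "rev y"] by simp
  have z': "z \<in> multinomial_words n v" "rev w \<sqsubseteq>\<^bsub>?M\<^esub> z" "rev u \<sqsubseteq>\<^bsub>?M\<^esub> z"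
    using z w u rev_in_multinomial_words by (auto simp: least_def Upper_def)
  have "rev z \<in> Lower ?M {w, u}"
    using z' w u by (auto simp: Lower_def rev_in_multinomial_words rev_le)
  moreover have "y \<sqsubseteq>\<^bsub>?M\<^esub> rev z" if "y \<in> Lower ?M {w, u}" for y
  proof -
    have y: "y \<in> multinomial_words n v" "y \<sqsubseteq>\<^bsub>?M\<^esub> w" "y \<sqsubseteq>\<^bsub>?M\<^esub> u"
      using that w u by (auto simp: Lower_def)
    then have "rev y \<in> Upper ?M {rev w, rev u}"
      by (auto simp: Upper_def rev_in_multinomial_words rev_le_iff)
    then have "z \<sqsubseteq>\<^bsub>?M\<^esub> rev y" using z by (auto simp: least_def)
    then show ?thesis using rev_le_iff[where w = "rev z" and u = y] by simp
  qed
  ultimately show ?thesis by (auto simp: greatest_def Lower_def)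
qed

lemma least_word:
  "\<exists>z. least (multinomial_lattice n v) z (multinomial_words n v) \<and> word_inversions z = {}"
proof -
  have "word_biclosed n v {}" by (simp add: word_biclosed_def biclosed_def trans_def)
  then obtain z where "z \<in> multinomial_words n v" "word_inversions z = {}"
    using word_with_inversions by blast
  then show ?thesis by (intro exI[of _ z]) (auto simp: least_def le_iff_inversions)
qed

lemma bounded_lattice_multinomial: "bounded_lattice (multinomial_lattice n v)"
proof -
  let ?M = "multinomial_lattice n v"
  interpret partial_order ?M by (rule partial_order_multinomial_lattice)
  obtain z where z: "least ?M z (multinomial_words n v)" using least_word by blast
  have "greatest ?M (rev z) (multinomial_words n v)"
    unfolding greatest_def
  proof (intro conjI ballI)
    fix y assume "y \<in> multinomial_words n v"
    then have "z \<sqsubseteq>\<^bsub>?M\<^esub> rev y" using z rev_in_multinomial_words by (auto simp: least_def)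
    then show "y \<sqsubseteq>\<^bsub>?M\<^esub> rev z" using rev_le_iff[where w = "rev z" and u = y] by simp
  qed (use z rev_in_multinomial_words in \<open>auto simp: least_def\<close>)
  with z show ?thesis
    by unfold_locales
      (use least_upper_bound_of_words greatest_lower_bound_of_words in fastforce)+
qed

lemma self_dual_multinomial: "self_dual_lattice (multinomial_lattice n v) rev"
  by (intro self_dual_lattice.intro self_dual_lattice_axioms.intro bounded_lattice_multinomial)
    (simp_all add: rev_in_multinomial_words rev_le_iff)

lemma join_inversions:
  assumes "w \<in> multinomial_words n v" "u \<in> multinomial_words n v"
  shows "word_inversions (w \<squnion>\<^bsub>multinomial_lattice n v\<^esub> u)
    = (word_inversions w \<union> word_inversions u)\<^sup>+"
  using least_upper_bound_of_words[OF assms]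
    partial_order.join_eqI[OF partial_order_multinomial_lattice] by blast

lemma bottom_inversions: "word_inversions \<bottom>\<^bsub>multinomial_lattice n v\<^esub> = {}"
proof -
  obtain z where z: "least (multinomial_lattice n v) z (multinomial_words n v)" "word_inversions z = {}"
    using least_word by blast
  then have "\<bottom>\<^bsub>multinomial_lattice n v\<^esub> = z"
    by (intro partial_order.bottom_eqI[OF partial_order_multinomial_lattice]) simp
  with z(2) show ?thesis by simp
qed


section \<open>Ranked join covers of words\<close>

definition arcs :: "nat \<Rightarrow> (nat \<Rightarrow> nat) \<Rightarrow>
    ((nat \<times> nat) \<times> (nat \<times> nat) \<times> (nat \<times> nat) set) set" where
  "arcs n v = {(p, q, V). p \<in> letter_copies n v \<and> q \<in> letter_copies n v \<and> V \<subseteq> letter_copies n v \<and>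
     p < q \<and> p \<notin> V \<and> q \<in> V \<and> (\<forall>(x, y)\<in>arc (letter_copies n v) p q V. fst x < fst y)}"

text \<open>The default of the choice operator is never met on \<open>arcs n v\<close>, by \<open>arc_word\<close> below.\<close>

definition arc_word :: "nat \<Rightarrow> (nat \<Rightarrow> nat) \<Rightarrow>
    (nat \<times> nat) \<times> (nat \<times> nat) \<times> (nat \<times> nat) set \<Rightarrow> nat list" where
  "arc_word n v = (\<lambda>(p, q, V). SOME w. w \<in> multinomial_words n v \<and>
     word_inversions w = arc (letter_copies n v) p q V)"

definition arc_length :: "nat \<Rightarrow> (nat \<Rightarrow> nat) \<Rightarrow>
    (nat \<times> nat) \<times> (nat \<times> nat) \<times> (nat \<times> nat) set \<Rightarrow> nat" where
  "arc_length n v = (\<lambda>(p, q, V). card {z \<in> letter_copies n v. p \<le> z \<and> z \<le> q})"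

lemma finite_arcs: "finite (arcs n v)"
proof (rule finite_subset)
  show "arcs n v \<subseteq> letter_copies n v \<times> letter_copies n v \<times> Pow (letter_copies n v)"
    unfolding arcs_def by blast
qed (simp add: finite_letter_copies)

lemma arc_word:
  assumes "(p, q, V) \<in> arcs n v"
  shows "arc_word n v (p, q, V) \<in> multinomial_words n v"
    "word_inversions (arc_word n v (p, q, V)) = arc (letter_copies n v) p q V"
proof -
  have "word_biclosed n v (arc (letter_copies n v) p q V)"
    using assms by (simp add: word_biclosed_def biclosed_arc arcs_def)
  then have "\<exists>w. w \<in> multinomial_words n v \<and> word_inversions w = arc (letter_copies n v) p q V"
    using word_with_inversions by blast
  from someI_ex[OF this] show "arc_word n v (p, q, V) \<in> multinomial_words n v"
    "word_inversions (arc_word n v (p, q, V)) = arc (letter_copies n v) p q V"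
    by (simp_all add: arc_word_def)
qed

lemma arc_length_less:
  assumes "p \<in> letter_copies n v" "q \<in> letter_copies n v" "p \<le> x" "x < y" "y \<le> q" "(x, y) \<noteq> (p, q)"
  shows "arc_length n v (x, y, V) < arc_length n v (p, q, V')"
proof -
  have "{z \<in> letter_copies n v. x \<le> z \<and> z \<le> y} \<subset> {z \<in> letter_copies n v. p \<le> z \<and> z \<le> q}"
  proof
    show "{z \<in> letter_copies n v. x \<le> z \<and> z \<le> y} \<subseteq> {z \<in> letter_copies n v. p \<le> z \<and> z \<le> q}"
      using assms by (blast intro: order_trans)
    have "p < x \<or> y < q" using assms by force
    then have "p \<notin> {z \<in> letter_copies n v. x \<le> z \<and> z \<le> y} \<or> q \<notin> {z \<in> letter_copies n v. x \<le> z \<and> z \<le> y}"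
      using not_le by blast
    moreover have "p \<le> q" using assms(3-5) by (meson less_imp_le order_trans)
    ultimately show "{z \<in> letter_copies n v. x \<le> z \<and> z \<le> y} \<noteq> {z \<in> letter_copies n v. p \<le> z \<and> z \<le> q}"
      using assms(1,2) by blast
  qed
  then show ?thesis
    unfolding arc_length_def using finite_letter_copies by (simp add: psubset_card_mono)
qed

lemma arc_word_through_inversion:
  assumes w: "w \<in> multinomial_words n v" and xy: "(x, y) \<in> word_inversions w"
  shows "\<exists>V. (x, y, V) \<in> arcs n v \<and> (x, y) \<in> word_inversions (arc_word n v (x, y, V)) \<and>
    arc_word n v (x, y, V) \<sqsubseteq>\<^bsub>multinomial_lattice n v\<^esub> w"
proof -
  let ?A = "letter_copies n v"
  have B: "biclosed ?A (word_inversions w)" "\<forall>(x, y)\<in>word_inversions w. fst x < fst y"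
    using word_biclosed_inversions[OF w] by (simp_all add: word_biclosed_def)
  note xy' = biclosedD(1-3)[OF B(1) xy]
  obtain V where V: "V \<subseteq> ?A" "x \<notin> V" "y \<in> V" "arc ?A x y V \<subseteq> word_inversions w"
    using arc_below_inversion[OF B(1) xy] by blast
  have "(x, y, V) \<in> arcs n v" using V xy' B(2) unfolding arcs_def by blast
  moreover have "(x, y) \<in> arc ?A x y V" using V xy' by (simp add: arc_def)
  ultimately show ?thesis using V(4) w by (metis arc_word le_iff_inversions)
qed

text \<open>
  Density holds because each inversion of a word lies in an arc below it. For the last condition, an
  inversion of \<open>b\<close> or \<open>c\<close> between \<open>p\<close> and \<open>q\<close>, other than \<open>(p, q)\<close>, is the outermost pair of an arc of smaller rank below
  \<open>b\<close> or \<open>c\<close>, hence an inversion of \<open>u\<close>; such pairs generate the arc.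
\<close>

lemma ranked_join_covers_multinomial:
  "ranked_join_covers (multinomial_lattice n v) (arcs n v) (arc_word n v) (arc_length n v)"
proof (intro ranked_join_covers.intro ranked_join_covers_axioms.intro bounded_lattice_multinomial)
  let ?M = "multinomial_lattice n v" and ?A = "letter_copies n v"
  interpret M: bounded_lattice ?M by (rule bounded_lattice_multinomial)
  note M.le_antisym [rule del]
  show "finite (arcs n v)" by (rule finite_arcs)
  show "arc_word n v \<kappa> \<in> carrier ?M" if "\<kappa> \<in> arcs n v" for \<kappa>
    using that by (cases \<kappa>) (simp add: arc_word)
  show "\<not> arc_word n v \<kappa> \<sqsubseteq>\<^bsub>?M\<^esub> \<bottom>\<^bsub>?M\<^esub>" if "\<kappa> \<in> arcs n v" for \<kappa>
  proof -
    obtain p q V where \<kappa>: "\<kappa> = (p, q, V)" by (cases \<kappa>)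
    have "(p, q) \<in> arc ?A p q V" using that by (simp add: \<kappa> arcs_def arc_def)
    then show ?thesis
      using that arc_word[of p q V n v] M.bottom_closed
      by (auto simp: \<kappa> le_iff_inversions bottom_inversions)
  qed
  show "a \<sqsubseteq>\<^bsub>?M\<^esub> b"
    if ab: "a \<in> carrier ?M" "b \<in> carrier ?M"
      and dense: "\<And>\<kappa>. \<kappa> \<in> arcs n v \<Longrightarrow> arc_word n v \<kappa> \<sqsubseteq>\<^bsub>?M\<^esub> a \<Longrightarrow> arc_word n v \<kappa> \<sqsubseteq>\<^bsub>?M\<^esub> b" for a b
  proof -
    have "word_inversions a \<subseteq> word_inversions b"
    proof (rule subrelI)
      fix x y assume "(x, y) \<in> word_inversions a"
      then obtain V where V: "(x, y, V) \<in> arcs n v" "(x, y) \<in> word_inversions (arc_word n v (x, y, V))"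
        "arc_word n v (x, y, V) \<sqsubseteq>\<^bsub>?M\<^esub> a"
        using arc_word_through_inversion ab(1) by (metis carrier_multinomial_lattice)
      from dense[OF V(1,3)] show "(x, y) \<in> word_inversions b"
        using V(2) ab(2) arc_word(1)[OF V(1)] by (auto simp: le_iff_inversions)
    qed
    with ab show ?thesis by (simp add: le_iff_inversions)
  qed
  show "arc_word n v \<kappa> \<sqsubseteq>\<^bsub>?M\<^esub> u"
    if \<kappa>: "\<kappa> \<in> arcs n v" and b: "b \<in> carrier ?M" and c: "c \<in> carrier ?M" and u: "u \<in> carrier ?M"
      and below: "arc_word n v \<kappa> \<sqsubseteq>\<^bsub>?M\<^esub> b \<squnion>\<^bsub>?M\<^esub> c"
      and not_below: "\<not> arc_word n v \<kappa> \<sqsubseteq>\<^bsub>?M\<^esub> b" "\<not> arc_word n v \<kappa> \<sqsubseteq>\<^bsub>?M\<^esub> c"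
      and shorter: "\<And>\<mu>. \<mu> \<in> arcs n v \<Longrightarrow> arc_length n v \<mu> < arc_length n v \<kappa> \<Longrightarrow>
        arc_word n v \<mu> \<sqsubseteq>\<^bsub>?M\<^esub> b \<or> arc_word n v \<mu> \<sqsubseteq>\<^bsub>?M\<^esub> c \<Longrightarrow> arc_word n v \<mu> \<sqsubseteq>\<^bsub>?M\<^esub> u"
    for \<kappa> b c u
  proof -
    obtain p q V where \<kappa>_eq: "\<kappa> = (p, q, V)" by (cases \<kappa>)
    note arc = arc_word[OF \<kappa>[unfolded \<kappa>_eq]]
    have bcu: "b \<in> multinomial_words n v" "c \<in> multinomial_words n v" "u \<in> multinomial_words n v"
      using b c u by simp_all
    have join: "b \<squnion>\<^bsub>?M\<^esub> c \<in> multinomial_words n v" using M.join_closed[OF b c] by simp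
    have pq: "p \<in> ?A" "q \<in> ?A" "p < q" "p \<notin> V" "q \<in> V" using \<kappa> by (simp_all add: \<kappa>_eq arcs_def)
    have "arc ?A p q V \<subseteq> word_inversions u"
    proof (rule short_inversions_generate_arc[OF _ _ _ pq])
      show "biclosed ?A (word_inversions b)" "biclosed ?A (word_inversions c)" "trans (word_inversions u)"
        using word_biclosed_inversions bcu by (auto simp: word_biclosed_def biclosed_def)
      show "arc ?A p q V \<subseteq> (word_inversions b \<union> word_inversions c)\<^sup>+"
        using below arc join bcu by (simp add: \<kappa>_eq le_iff_inversions join_inversions)
      show "\<not> arc ?A p q V \<subseteq> word_inversions b" "\<not> arc ?A p q V \<subseteq> word_inversions c"
        using not_below arc bcu by (simp_all add: \<kappa>_eq le_iff_inversions)
      fix x y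
      assume xy: "(x, y) \<in> word_inversions b \<union> word_inversions c" "p \<le> x" "y \<le> q" "(x, y) \<noteq> (p, q)"
      obtain V' where V': "(x, y, V') \<in> arcs n v" "(x, y) \<in> word_inversions (arc_word n v (x, y, V'))"
        "arc_word n v (x, y, V') \<sqsubseteq>\<^bsub>?M\<^esub> b \<or> arc_word n v (x, y, V') \<sqsubseteq>\<^bsub>?M\<^esub> c"
        using xy(1) arc_word_through_inversion[OF bcu(1), of x y]
          arc_word_through_inversion[OF bcu(2), of x y] by blast
      have "x < y" using V'(1) by (simp add: arcs_def)
      then have "arc_word n v (x, y, V') \<sqsubseteq>\<^bsub>?M\<^esub> u"
        using shorter[OF V'(1) _ V'(3)] arc_length_less[OF pq(1,2) xy(2) _ xy(3,4)] by (simp add: \<kappa>_eq)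
      then show "(x, y) \<in> word_inversions u"
        using V'(2) bcu(3) arc_word(1)[OF V'(1)] by (auto simp: le_iff_inversions)
    qed
    then show ?thesis using arc bcu(3) by (simp add: \<kappa>_eq le_iff_inversions)
  qed
qed

theorem corollary3p8:
  fixes n :: nat and v :: "nat \<Rightarrow> nat"
  shows "mckenzie_bounded (multinomial_lattice n v)"
proof (rule mckenzie_boundedI)
  note least = ranked_join_covers.least_term_exists[OF ranked_join_covers_multinomial]
  show "bounded_lattice (multinomial_lattice n v)" by (rule bounded_lattice_multinomial)
  show "finite (carrier (multinomial_lattice n v))" by (simp add: finite_multinomial_words)
  fix X :: "nat set" and f :: "nat \<Rightarrow> nat list" and a
  assume *: "finite X" "\<And>x. f x \<in> carrier (multinomial_lattice n v)"
    "a \<in> carrier (multinomial_lattice n v)"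
  from * show "\<exists>t\<in>lat_terms X. \<forall>s\<in>lat_terms X.
      a \<sqsubseteq>\<^bsub>multinomial_lattice n v\<^esub> lat_eval (multinomial_lattice n v) f s \<longleftrightarrow> lat_le t s"
    by (rule least)
  from * show "\<exists>t\<in>lat_terms X. \<forall>s\<in>lat_terms X.
      lat_eval (multinomial_lattice n v) f s \<sqsubseteq>\<^bsub>multinomial_lattice n v\<^esub> a \<longleftrightarrow> lat_le s t"
    by (intro self_dual_lattice.greatest_term_exists[OF self_dual_multinomial] least)
qed

end
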